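(* Let $\ell\ge 2$. The Lee monoid $L_\ell^1$ is finitely based if and only if $\ell=2$.
   Context: For $\ell\ge 2$, $L_\ell$ is the semigroup with zero $0$ given by $$L_\ell=\langle a,b\mid aa=a,\ bb=b,\ \underbrace{ababab\cdots}_{\text{length }\ell}=0\rangle,$$ and the Lee monoid $L_\ell^1$ is the monoid obtained by adjoining an identity element to $L_\ell$. An identity is a formal equality of words over a countably infinite alphabet of variables. A semigroup (or monoid) is finitely based if there is a finite subset of its identities from which all of its identities can be deduced. *)

theory Defs
  imports "HOL-Algebra.Group"
begin

section \<open>Presented semigroups\<close>

text \<open>The congruence on words generated by a set of defining relations. The one-step rule
  multiplies by arbitrary, possibly empty, words on both sides, so if all words in \<open>R\<close> are
  nonempty its restriction to nonempty words is the congruence of the free semigroup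
  generated by \<open>R\<close>.\<close>

inductive word_cong :: "('g list \<times> 'g list) set \<Rightarrow> 'g list \<Rightarrow> 'g list \<Rightarrow> bool"
  for R where
  rel: "(u, v) \<in> R \<Longrightarrow> word_cong R u v"
| refl: "word_cong R u u"
| sym: "word_cong R u v \<Longrightarrow> word_cong R v u"
| trans: "word_cong R u v \<Longrightarrow> word_cong R v w \<Longrightarrow> word_cong R u w"
| mult: "word_cong R u v \<Longrightarrow> word_cong R (p @ u @ q) (p @ v @ q)"

definition word_cong_rel :: "('g list \<times> 'g list) set \<Rightarrow> ('g list \<times> 'g list) set" where
  "word_cong_rel R = {(u, v). u \<noteq> [] \<and> v \<noteq> [] \<and> word_cong R u v}"

definition pres_carrier :: "('g list \<times> 'g list) set \<Rightarrow> 'g list set set" where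
  "pres_carrier R = {w. w \<noteq> []} // word_cong_rel R"

text \<open>The union is over mutually equal classes when \<open>X\<close> and \<open>Y\<close> are classes.\<close>

definition pres_mult :: "('g list \<times> 'g list) set \<Rightarrow> 'g list set \<Rightarrow> 'g list set \<Rightarrow> 'g list set" where
  "pres_mult R X Y = (\<Union>u\<in>X. \<Union>v\<in>Y. word_cong_rel R `` {u @ v})"

section \<open>Lee monoids\<close>

text \<open>\<open>None\<close> is the new identity element.\<close>

fun adjoin_mult :: "('a \<Rightarrow> 'a \<Rightarrow> 'a) \<Rightarrow> 'a option \<Rightarrow> 'a option \<Rightarrow> 'a option" where
  "adjoin_mult f None y = y"
| "adjoin_mult f (Some x) None = Some x"
| "adjoin_mult f (Some x) (Some y) = Some (f x y)"

definition adjoin_identity :: "'a set \<Rightarrow> ('a \<Rightarrow> 'a \<Rightarrow> 'a) \<Rightarrow> 'a option monoid" where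
  "adjoin_identity S f =
     \<lparr>carrier = insert None (Some ` S), mult = adjoin_mult f, one = None\<rparr>"

text \<open>A presentation of a semigroup with zero is read as a semigroup presentation with an
  additional generator \<open>Zero\<close> and the relations making it a zero element.\<close>

datatype lee_gen = A | B | Zero

definition alternating_word :: "nat \<Rightarrow> lee_gen list" where
  "alternating_word l = map (\<lambda>i. if even i then A else B) [0..<l]"

definition lee_relations :: "nat \<Rightarrow> (lee_gen list \<times> lee_gen list) set" where
  "lee_relations l =
     {([A, A], [A]), ([B, B], [B]), (alternating_word l, [Zero])}
     \<union> {([Zero, x], [Zero]) | x. True} \<union> {([x, Zero], [Zero]) | x. True}"

definition lee_monoid :: "nat \<Rightarrow> lee_gen list set option monoid" where
  "lee_monoid l =
     adjoin_identity (pres_carrier (lee_relations l)) (pres_mult (lee_relations l))"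

section \<open>Identities and finite bases\<close>

text \<open>Identities are taken in the signature of monoids: words over the variables \<open>nat\<close> may be
  empty, the empty word standing for the identity element.\<close>

type_synonym identity = "nat list \<times> nat list"

definition eval_word :: "('a, 'b) monoid_scheme \<Rightarrow> (nat \<Rightarrow> 'a) \<Rightarrow> nat list \<Rightarrow> 'a" where
  "eval_word M \<phi> w = foldr (\<lambda>x y. \<phi> x \<otimes>\<^bsub>M\<^esub> y) w \<one>\<^bsub>M\<^esub>"

definition identities_of :: "('a, 'b) monoid_scheme \<Rightarrow> identity set" where
  "identities_of M =
     {(u, v). \<forall>\<phi>. (\<forall>x. \<phi> x \<in> carrier M) \<longrightarrow> eval_word M \<phi> u = eval_word M \<phi> v}"

definition subst_word :: "(nat \<Rightarrow> nat list) \<Rightarrow> nat list \<Rightarrow> nat list" where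
  "subst_word \<sigma> w = concat (map \<sigma> w)"

inductive deducible :: "identity set \<Rightarrow> nat list \<Rightarrow> nat list \<Rightarrow> bool"
  for \<Sigma> where
  ax: "(u, v) \<in> \<Sigma> \<Longrightarrow> deducible \<Sigma> u v"
| refl: "deducible \<Sigma> u u"
| sym: "deducible \<Sigma> u v \<Longrightarrow> deducible \<Sigma> v u"
| trans: "deducible \<Sigma> u v \<Longrightarrow> deducible \<Sigma> v w \<Longrightarrow> deducible \<Sigma> u w"
| mult: "deducible \<Sigma> u v \<Longrightarrow> deducible \<Sigma> u' v' \<Longrightarrow> deducible \<Sigma> (u @ u') (v @ v')"
| subst: "deducible \<Sigma> u v \<Longrightarrow> deducible \<Sigma> (subst_word \<sigma> u) (subst_word \<sigma> v)"

definition finitely_based :: "('a, 'b) monoid_scheme \<Rightarrow> bool" where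
  "finitely_based M \<longleftrightarrow>
     (\<exists>\<Sigma>. \<Sigma> \<subseteq> identities_of M \<and> finite \<Sigma> \<and>
          (\<forall>(u, v) \<in> identities_of M. deducible \<Sigma> u v))"

section \<open>Lee monoids are monoids\<close>

lemma equiv_word_cong_rel: "equiv {w. w \<noteq> []} (word_cong_rel R)"
  by (rule equivI)
    (auto simp: word_cong_rel_def refl_on_def sym_def trans_def
      intro: word_cong.refl word_cong.sym word_cong.trans)

lemma word_cong_append:
  assumes "word_cong R u u'" "word_cong R v v'"
  shows "word_cong R (u @ v) (u' @ v')"
  using word_cong.mult[OF assms(1), of "[]" v] word_cong.mult[OF assms(2), of u' "[]"]
  by (auto intro: word_cong.trans)

lemma pres_mult_class:
  assumes "u \<noteq> []" "v \<noteq> []"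
  shows "pres_mult R (word_cong_rel R `` {u}) (word_cong_rel R `` {v}) =
    word_cong_rel R `` {u @ v}"
proof -
  have "word_cong_rel R `` {u' @ v'} = word_cong_rel R `` {u @ v}"
    if "(u, u') \<in> word_cong_rel R" "(v, v') \<in> word_cong_rel R" for u' v'
    using that equiv_class_eq[OF equiv_word_cong_rel, of "u @ v" "u' @ v'" R]
    by (auto simp: word_cong_rel_def intro: word_cong_append)
  moreover have "(u, u) \<in> word_cong_rel R" "(v, v) \<in> word_cong_rel R"
    using assms by (auto simp: word_cong_rel_def intro: word_cong.refl)
  ultimately show ?thesis
    unfolding pres_mult_def by blast
qed

lemma pres_carrier_cases:
  assumes "X \<in> pres_carrier R"
  obtains u where "u \<noteq> []" "X = word_cong_rel R `` {u}"
  using assms unfolding pres_carrier_def by (auto elim!: quotientE)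

lemma pres_carrierI: "u \<noteq> [] \<Longrightarrow> word_cong_rel R `` {u} \<in> pres_carrier R"
  unfolding pres_carrier_def by (auto intro: quotientI)

lemma pres_mult_closed:
  "X \<in> pres_carrier R \<Longrightarrow> Y \<in> pres_carrier R \<Longrightarrow> pres_mult R X Y \<in> pres_carrier R"
  by (elim pres_carrier_cases) (auto simp: pres_mult_class intro: pres_carrierI)

lemma pres_mult_assoc:
  "X \<in> pres_carrier R \<Longrightarrow> Y \<in> pres_carrier R \<Longrightarrow> Z \<in> pres_carrier R \<Longrightarrow>
   pres_mult R (pres_mult R X Y) Z = pres_mult R X (pres_mult R Y Z)"
  by (elim pres_carrier_cases) (auto simp: pres_mult_class)

lemma monoid_lee_monoid: "monoid (lee_monoid l)"
proof (rule monoidI)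
  fix x y assume "x \<in> carrier (lee_monoid l)" "y \<in> carrier (lee_monoid l)"
  then show "x \<otimes>\<^bsub>lee_monoid l\<^esub> y \<in> carrier (lee_monoid l)"
    by (auto simp: lee_monoid_def adjoin_identity_def pres_mult_closed)
next
  fix x y z
  assume "x \<in> carrier (lee_monoid l)" "y \<in> carrier (lee_monoid l)" "z \<in> carrier (lee_monoid l)"
  then show "x \<otimes>\<^bsub>lee_monoid l\<^esub> y \<otimes>\<^bsub>lee_monoid l\<^esub> z = x \<otimes>\<^bsub>lee_monoid l\<^esub> (y \<otimes>\<^bsub>lee_monoid l\<^esub> z)"
    by (auto simp: lee_monoid_def adjoin_identity_def pres_mult_assoc)
qed (auto simp: lee_monoid_def adjoin_identity_def)

end

theory Submission
  imports Defs "HOL-Library.Sublist"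
begin

text \<open>For \<open>l = 2\<close> a product vanishes as soon as some \<open>a\<close> precedes some \<open>b\<close>, so an identity is
  governed by which letters occur, which occur once, and for which pairs some \<open>x\<close> precedes some
  \<open>y\<close>. Words with these data in common are connected by deleting inner occurrences and by swapping
  adjacent first, or adjacent last, occurrences.

  For \<open>l \<ge> 3\<close> consider a path of letters \<open>0, \<dots>, 2 * N\<close> and let \<open>zig\<close> be a product of \<open>l\<close>-th powers
  of words over independent sets, the odd letters coming in one after the other and then leaving in
  the same order. Let \<open>zag\<close> run through the same powers backwards. Two nonadjacent letters of
  different parity share a power, so they can only be sent to \<open>a\<close> and \<open>b\<close> at the cost of getting
  \<open>0\<close>; if no such pair arises, both words become \<open>bab\<close> (or \<open>aba\<close>), or a power of a single
  generator. So \<open>zig = zag\<close> is an identity of the Lee monoid. In every word equal to \<open>zig\<close>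
  the order in which the odd letters first occur is either increasing or decreasing, and any two
  consecutive odd letters determine which. An identity that is short compared with \<open>N\<close> leaves intact
  a block containing the first occurrences of two consecutive odd letters, and hence cannot lead
  from \<open>zig\<close> to \<open>zag\<close>.\<close>

section \<open>Identities as congruences of substituted words\<close>

abbreviation replace :: "(nat \<Rightarrow> 'g list) \<Rightarrow> nat list \<Rightarrow> 'g list" where
  "replace \<psi> w \<equiv> concat (map \<psi> w)"

lemma replace_subst_word: "replace \<psi> (subst_word \<sigma> w) = replace (\<lambda>x. replace \<psi> (\<sigma> x)) w"
  by (induction w) (auto simp: subst_word_def)

lemma word_cong_context:
  "word_cong R u v \<Longrightarrow> word_cong R (p @ u) (p @ v)"
  "word_cong R u v \<Longrightarrow> word_cong R (u @ q) (v @ q)"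
  using word_cong.mult[of R u v p "[]"] word_cong.mult[of R u v "[]" q] by simp_all

lemma word_cong_class_eq:
  assumes "u \<noteq> []" "v \<noteq> []"
  shows "word_cong_rel R `` {u} = word_cong_rel R `` {v} \<longleftrightarrow> word_cong R u v"
  using assms eq_equiv_class_iff[OF equiv_word_cong_rel, of u v R]
  by (auto simp: word_cong_rel_def)

lemma alternating_word_Suc:
  "alternating_word (Suc n) = alternating_word n @ [if even n then A else B]"
  by (simp add: alternating_word_def)

lemma alternating_word_nonempty: "l \<ge> 1 \<Longrightarrow> alternating_word l \<noteq> []"
  by (simp add: alternating_word_def)

text \<open>For \<open>l \<ge> 1\<close> no relation has an empty side, so the empty word is alone
  in its class and can name the adjoined identity.\<close>

lemma word_cong_lee_Nil:
  assumes "word_cong (lee_relations l) u v" "l \<ge> 1"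
  shows "u = [] \<longleftrightarrow> v = []"
  using assms(1)
  by induction (use alternating_word_nonempty[OF assms(2)] in \<open>auto simp: lee_relations_def\<close>)

definition lee_value :: "nat \<Rightarrow> lee_gen list \<Rightarrow> lee_gen list set option" where
  "lee_value l w = (if w = [] then None else Some (word_cong_rel (lee_relations l) `` {w}))"

lemma lee_value_eq_iff:
  "l \<ge> 1 \<Longrightarrow> lee_value l u = lee_value l v \<longleftrightarrow> word_cong (lee_relations l) u v"
  using word_cong_lee_Nil[of l u v]
  by (auto simp: lee_value_def word_cong_class_eq intro: word_cong.refl)

lemma lee_value_in_carrier: "lee_value l w \<in> carrier (lee_monoid l)"
  by (auto simp: lee_value_def lee_monoid_def adjoin_identity_def intro: pres_carrierI)

lemma lee_value_surj:
  assumes "x \<in> carrier (lee_monoid l)"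
  obtains w where "x = lee_value l w"
proof (cases x)
  case None
  then show ?thesis using that[of "[]"] by (simp add: lee_value_def)
next
  case (Some X)
  with assms have "X \<in> pres_carrier (lee_relations l)"
    by (auto simp: lee_monoid_def adjoin_identity_def)
  then obtain u where "u \<noteq> []" "X = word_cong_rel (lee_relations l) `` {u}"
    by (rule pres_carrier_cases)
  then show ?thesis using that[of u] Some by (simp add: lee_value_def)
qed

lemma lee_value_append:
  "lee_value l u \<otimes>\<^bsub>lee_monoid l\<^esub> lee_value l v = lee_value l (u @ v)"
  by (auto simp: lee_value_def lee_monoid_def adjoin_identity_def pres_mult_class)

lemma eval_word_lee_value:
  "eval_word (lee_monoid l) (\<lambda>x. lee_value l (\<psi> x)) w = lee_value l (replace \<psi> w)"
proof (induction w)
  case Nil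
  then show ?case by (simp add: eval_word_def lee_value_def lee_monoid_def adjoin_identity_def)
next
  case (Cons x w)
  then show ?case by (simp add: eval_word_def lee_value_append)
qed

text \<open>Every element is the value of a word, so assignments may be taken to be word
  substitutions; from here on identities are statements about \<open>word_cong\<close>.\<close>

lemma identities_of_lee_monoid_iff:
  assumes "l \<ge> 1"
  shows "(u, v) \<in> identities_of (lee_monoid l) \<longleftrightarrow>
    (\<forall>\<psi>. word_cong (lee_relations l) (replace \<psi> u) (replace \<psi> v))"
proof
  assume *: "(u, v) \<in> identities_of (lee_monoid l)"
  show "\<forall>\<psi>. word_cong (lee_relations l) (replace \<psi> u) (replace \<psi> v)"
  proof
    fix \<psi>
    have "eval_word (lee_monoid l) (\<lambda>x. lee_value l (\<psi> x)) u =
        eval_word (lee_monoid l) (\<lambda>x. lee_value l (\<psi> x)) v"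
      using * lee_value_in_carrier by (auto simp: identities_of_def)
    then show "word_cong (lee_relations l) (replace \<psi> u) (replace \<psi> v)"
      using assms by (simp add: eval_word_lee_value lee_value_eq_iff)
  qed
next
  assume *: "\<forall>\<psi>. word_cong (lee_relations l) (replace \<psi> u) (replace \<psi> v)"
  have "eval_word (lee_monoid l) \<phi> u = eval_word (lee_monoid l) \<phi> v"
    if "\<forall>x. \<phi> x \<in> carrier (lee_monoid l)" for \<phi>
  proof -
    have "\<exists>w. \<phi> x = lee_value l w" for x
      using that lee_value_surj by blast
    then obtain \<psi> where "\<phi> = (\<lambda>x. lee_value l (\<psi> x))"
      by metis
    then show ?thesis
      using * assms by (simp add: eval_word_lee_value lee_value_eq_iff)
  qed
  then show "(u, v) \<in> identities_of (lee_monoid l)"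
    by (simp add: identities_of_def)
qed

text \<open>The induction is uniform in \<open>\<psi>\<close>, because the substitution rule
  replaces \<open>\<psi>\<close> by its composite with \<open>\<sigma>\<close>.\<close>

lemma deducible_sound:
  assumes "deducible \<Sigma> u v" "\<Sigma> \<subseteq> identities_of (lee_monoid l)" "l \<ge> 1"
  shows "(u, v) \<in> identities_of (lee_monoid l)"
proof -
  have "word_cong (lee_relations l) (replace \<psi> u) (replace \<psi> v)" for \<psi>
    using assms(1)
  proof (induction arbitrary: \<psi>)
    case (ax u v)
    then show ?case using assms(2,3) identities_of_lee_monoid_iff by blast
  next
    case (mult u v u' v')
    then show ?case by (simp add: word_cong_append)
  next
    case (subst u v \<sigma>)
    then show ?case by (simp add: replace_subst_word)
  qed (auto intro: word_cong.intros)
  then show ?thesis using assms(3) by (simp add: identities_of_lee_monoid_iff)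
qed

lemma identities_of_sym: "(u, v) \<in> identities_of M \<Longrightarrow> (v, u) \<in> identities_of M"
  by (auto simp: identities_of_def)

lemma identities_of_trans:
  "(u, v) \<in> identities_of M \<Longrightarrow> (v, w) \<in> identities_of M \<Longrightarrow> (u, w) \<in> identities_of M"
  by (simp add: identities_of_def)

section \<open>Congruence of words over the generators of a Lee semigroup\<close>

lemma lee_cong_Zero:
  assumes "Zero \<in> set w"
  shows "word_cong (lee_relations l) w [Zero]"
proof -
  have left: "word_cong (lee_relations l) (p @ [Zero]) [Zero]" for p
  proof (induction p)
    case (Cons c p)
    have "word_cong (lee_relations l) ([c] @ p @ [Zero]) ([c] @ [Zero])"
      by (rule word_cong_context(1)[OF Cons])
    moreover have "word_cong (lee_relations l) [c, Zero] [Zero]"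
      by (rule word_cong.rel) (auto simp: lee_relations_def)
    ultimately show ?case by (auto intro: word_cong.trans)
  qed (simp add: word_cong.refl)
  have right: "word_cong (lee_relations l) ([Zero] @ q) [Zero]" for q
  proof (induction q rule: rev_induct)
    case (snoc c q)
    have "word_cong (lee_relations l) (([Zero] @ q) @ [c]) ([Zero] @ [c])"
      by (rule word_cong_context(2)[OF snoc])
    moreover have "word_cong (lee_relations l) [Zero, c] [Zero]"
      by (rule word_cong.rel) (auto simp: lee_relations_def)
    ultimately show ?case by (auto intro: word_cong.trans)
  qed (simp add: word_cong.refl)
  obtain p q where "w = p @ Zero # q"
    using assms by (meson split_list)
  moreover have "word_cong (lee_relations l) ((p @ [Zero]) @ q) ([Zero] @ q)"
    by (rule word_cong_context(2)[OF left])
  ultimately show ?thesis using right word_cong.trans by fastforce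
qed

lemma lee_cong_alternating:
  "word_cong (lee_relations l) (p @ alternating_word l @ q) [Zero]"
proof -
  have "word_cong (lee_relations l) (alternating_word l) [Zero]"
    by (rule word_cong.rel) (auto simp: lee_relations_def)
  then have "word_cong (lee_relations l) (p @ alternating_word l @ q) (p @ [Zero] @ q)"
    by (rule word_cong.mult)
  moreover have "word_cong (lee_relations l) (p @ [Zero] @ q) [Zero]"
    by (rule lee_cong_Zero) simp
  ultimately show ?thesis by (rule word_cong.trans)
qed

lemma lee_cong_idem:
  assumes "c \<noteq> Zero"
  shows "word_cong (lee_relations l) [c, c] [c]"
  by (rule word_cong.rel) (use assms in \<open>cases c; auto simp: lee_relations_def\<close>)

lemma lee_cong_power:
  assumes "set w \<subseteq> {c}" "w \<noteq> []" "c \<noteq> Zero"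
  shows "word_cong (lee_relations l) w [c]"
  using assms(1,2)
proof (induction w)
  case (Cons d w)
  then have [simp]: "d = c" by simp
  show ?case
  proof (cases "w = []")
    case False
    then have "word_cong (lee_relations l) ([c] @ w) ([c] @ [c])"
      using Cons by (intro word_cong_context) auto
    then show ?thesis
      using lee_cong_idem[OF assms(3)] word_cong.trans by fastforce
  qed (simp add: word_cong.refl)
qed simp

lemma subseq2_append:
  "subseq [x, y] (u @ v) \<longleftrightarrow> subseq [x, y] u \<or> subseq [x, y] v \<or> (x \<in> set u \<and> y \<in> set v)"
  (is "?l \<longleftrightarrow> ?r")
proof
  show "?l \<Longrightarrow> ?r"
    unfolding subseq_append_iff by (auto simp: Cons_eq_append_conv subseq_singleton_left)
  show "?r \<Longrightarrow> ?l"
    using list_emb_append_mono[of "(=)" "[x]" u "[y]" v]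
    by (auto simp: subseq_singleton_left intro: subseq_drop_many subseq_rev_drop_many)
qed

lemma subseq3_append:
  "subseq [x, y, z] (u @ v) \<longleftrightarrow> subseq [x, y, z] u \<or> subseq [x, y, z] v \<or>
     (x \<in> set u \<and> subseq [y, z] v) \<or> (subseq [x, y] u \<and> z \<in> set v)"
  (is "?l \<longleftrightarrow> ?r")
proof
  show "?l \<Longrightarrow> ?r"
    unfolding subseq_append_iff by (auto simp: Cons_eq_append_conv subseq_singleton_left)
  show "?r \<Longrightarrow> ?l"
    using list_emb_append_mono[of "(=)" "[x]" u "[y, z]" v]
      list_emb_append_mono[of "(=)" "[x, y]" u "[z]" v]
    by (auto simp: subseq_singleton_left intro: subseq_drop_many subseq_rev_drop_many)
qed

lemma subseq2_subset: "subseq [x, y] w \<Longrightarrow> x \<in> set w \<and> y \<in> set w"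
  using list_emb_set[of "(=)" "[x, y]" w] by auto

text \<open>Sending \<open>x\<close> to a generator and erasing all other letters detects
  \<open>x\<close> by whether the image is empty.\<close>

lemma identity_set_eq:
  assumes "(u, v) \<in> identities_of (lee_monoid l)" "l \<ge> 1"
  shows "set u = set v"
proof -
  have "x \<in> set u \<longleftrightarrow> x \<in> set v" for x
  proof -
    define \<psi> where "\<psi> c = (if c = x then [A] else [])" for c
    have "replace \<psi> w = [] \<longleftrightarrow> x \<notin> set w" for w
      by (auto simp: \<psi>_def)
    moreover have "word_cong (lee_relations l) (replace \<psi> u) (replace \<psi> v)"
      using assms identities_of_lee_monoid_iff by blast
    ultimately show ?thesis
      using word_cong_lee_Nil assms(2) by blast
  qed
  then show ?thesis by blast
qed

section \<open>The case of length two\<close>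

text \<open>A combinatorial description of the words that are 0 in \<open>L_2\<close>, where
  \<open>ab = 0\<close>; that it is exact follows from \<open>lee2_cong_iff\<close>.\<close>

definition lee2_zero :: "lee_gen list \<Rightarrow> bool" where
  "lee2_zero w \<longleftrightarrow> Zero \<in> set w \<or> subseq [A, B] w"

lemma lee2_zero_append:
  "lee2_zero (u @ v) \<longleftrightarrow> lee2_zero u \<or> lee2_zero v \<or> (A \<in> set u \<and> B \<in> set v)"
  by (auto simp: lee2_zero_def subseq2_append)

lemma lee2_zero_simps [simp]:
  "\<not> lee2_zero []" "\<not> lee2_zero [A]" "\<not> lee2_zero [B]" "lee2_zero (Zero # w)"
  by (auto simp: lee2_zero_def)

text \<open>The letters of a nonzero word are carried along because they decide whether a product
  with a context vanishes.\<close>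

lemma lee2_cong_invariant:
  assumes "word_cong (lee_relations 2) u v"
  shows "(lee2_zero u \<longleftrightarrow> lee2_zero v) \<and> (\<not> lee2_zero u \<longrightarrow> set u = set v)"
  using assms
proof induction
  case (rel u v)
  have [simp]: "alternating_word 2 = [A, B]"
    by (simp add: alternating_word_def numeral_2_eq_2)
  from rel show ?case
    by (auto simp: lee_relations_def) (auto simp: lee2_zero_def)
next
  case (mult u v p q)
  then show ?case by (auto simp: lee2_zero_append)
qed auto

text \<open>In a nonzero word every \<open>B\<close> precedes every \<open>A\<close>, so idempotency
  leaves one of the empty word, \<open>b\<close>, \<open>a\<close>, \<open>ba\<close>.\<close>

lemma lee2_cong_normal_form:
  assumes "\<not> lee2_zero w"
  shows "word_cong (lee_relations 2) w
    ((if B \<in> set w then [B] else []) @ (if A \<in> set w then [A] else []))"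
  using assms
proof (induction w)
  case (Cons c w)
  let ?R = "lee_relations 2" and ?n = "\<lambda>w. (if B \<in> set w then [B] else []) @ (if A \<in> set w then [A] else [])"
  have w: "\<not> lee2_zero w" and c: "c \<noteq> Zero" and AB: "c = A \<Longrightarrow> B \<notin> set w"
    using Cons.prems lee2_zero_append[of "[c]" w] by auto
  have "word_cong ?R ([c] @ w) ([c] @ ?n w)"
    by (rule word_cong_context(1)[OF Cons.IH[OF w]])
  moreover have "word_cong ?R ([c] @ ?n w) (?n (c # w))"
  proof (cases c)
    case A
    then show ?thesis using AB lee_cong_idem[of A 2] by (auto intro: word_cong.refl)
  next
    case B
    then show ?thesis
      using word_cong_context(2)[OF lee_cong_idem[of B 2], of "[A]"] lee_cong_idem[of B 2]
      by (auto intro: word_cong.refl)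
  qed (use c in simp)
  ultimately show ?case by (auto intro: word_cong.trans)
qed (simp add: word_cong.refl)

text \<open>Between an \<open>A\<close> and the next \<open>B\<close> after it there are only
  \<open>A\<close>s; they collapse and leave the factor \<open>ab\<close>.\<close>

lemma lee2_cong_Zero:
  assumes "lee2_zero w"
  shows "word_cong (lee_relations 2) w [Zero]"
proof (cases "Zero \<in> set w")
  case False
  with assms have "subseq [A, B] w" by (simp add: lee2_zero_def)
  then obtain p q where w: "w = p @ A # q" "B \<in> set q"
    using list_emb_ConsD[of "(=)" A "[B]" w] by (auto simp: subseq_singleton_left)
  then obtain q1 q2 where q: "q = q1 @ B # q2" "B \<notin> set q1"
    by (meson split_list_first)
  have "set (A # q1) \<subseteq> {A}"
  proof
    fix c assume "c \<in> set (A # q1)"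
    then show "c \<in> {A}" using False w q lee_gen.exhaust[of c "c = A"] by auto
  qed
  then have "word_cong (lee_relations 2) (A # q1) [A]"
    by (rule lee_cong_power) auto
  then have "word_cong (lee_relations 2) (p @ (A # q1) @ B # q2) (p @ [A] @ B # q2)"
    by (rule word_cong.mult)
  moreover have "alternating_word 2 = [A, B]"
    by (simp add: alternating_word_def numeral_2_eq_2)
  ultimately show ?thesis
    using lee_cong_alternating[of 2 p q2] w q by (auto intro: word_cong.trans)
qed (rule lee_cong_Zero)

lemma lee2_cong_iff:
  "word_cong (lee_relations 2) u v \<longleftrightarrow>
     (lee2_zero u \<longleftrightarrow> lee2_zero v) \<and> (\<not> lee2_zero u \<longrightarrow> set u = set v)"
proof
  assume *: "(lee2_zero u \<longleftrightarrow> lee2_zero v) \<and> (\<not> lee2_zero u \<longrightarrow> set u = set v)"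
  show "word_cong (lee_relations 2) u v"
  proof (cases "lee2_zero u")
    case True
    then show ?thesis
      using * lee2_cong_Zero by (blast intro: word_cong.sym word_cong.trans)
  next
    case False
    then have "set u = set v" "\<not> lee2_zero v" using * by auto
    then show ?thesis
      using lee2_cong_normal_form[OF False] lee2_cong_normal_form[of v]
      by (auto intro: word_cong.sym word_cong.trans)
  qed
qed (rule lee2_cong_invariant)

lemma identity2_subseq_iff:
  assumes "(u, v) \<in> identities_of (lee_monoid 2)"
  shows "subseq [x, y] u \<longleftrightarrow> subseq [x, y] v"
proof -
  \<comment> \<open>The order matters for \<open>x = y\<close>: the value \<open>ba\<close> is
    nonzero while its square is zero, so the case \<open>[x, x]\<close> detects a second
    occurrence.\<close>
  define \<psi> where "\<psi> c = (if c = y then [B] else []) @ (if c = x then [A] else [])" for c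
  have A: "A \<in> set (replace \<psi> w) \<longleftrightarrow> x \<in> set w" for w
    by (auto simp: \<psi>_def)
  have B: "B \<in> set (replace \<psi> w) \<longleftrightarrow> y \<in> set w" for w
    by (auto simp: \<psi>_def)
  have "lee2_zero (replace \<psi> w) \<longleftrightarrow> subseq [x, y] w" for w
  proof (induction w)
    case (Cons c w)
    have "lee2_zero (replace \<psi> (c # w)) \<longleftrightarrow>
        lee2_zero (replace \<psi> w) \<or> (A \<in> set (\<psi> c) \<and> B \<in> set (replace \<psi> w))"
      by (auto simp: lee2_zero_append) (auto simp: \<psi>_def lee2_zero_def split: if_splits)
    also have "\<dots> \<longleftrightarrow> subseq [x, y] w \<or> (c = x \<and> y \<in> set w)"
      unfolding Cons B by (auto simp: \<psi>_def)
    also have "\<dots> \<longleftrightarrow> subseq [x, y] (c # w)"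
      using subseq2_append[of x y "[c]" w] by auto
    finally show ?case .
  qed simp
  moreover have "word_cong (lee_relations 2) (replace \<psi> u) (replace \<psi> v)"
    using assms identities_of_lee_monoid_iff[of 2] by simp
  ultimately show ?thesis
    using lee2_cong_iff by blast
qed

section \<open>A finite basis for \<open>l = 2\<close>\<close>

text \<open>With x, y for the variables 0, 1 and h, k for 2, 3 these are xhxkx = xhkx, xyhxky =
  yxhxky and xhykxy = xhykyx. Since h and k may be replaced by the empty word, no separate versions
  without gaps have to be listed.\<close>

definition lee2_basis :: "identity set" where
  "lee2_basis =
     {([0, 2, 0, 3, 0], [0, 2, 3, 0]),
      ([0, 1, 2, 0, 3, 1], [1, 0, 2, 0, 3, 1]),
      ([0, 2, 1, 3, 0, 1], [0, 2, 1, 3, 1, 0])}"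

text \<open>By \<open>lee2_cong_iff\<close> and \<open>lee2_zero_append\<close> each identity turns
  into a propositional statement about the letters and the vanishing of the values of its
  variables.\<close>

lemma lee2_basis_identities: "lee2_basis \<subseteq> identities_of (lee_monoid 2)"
proof
  fix e assume "e \<in> lee2_basis"
  then obtain u v where e: "e = (u, v)" "(u, v) \<in> lee2_basis" by (cases e) auto
  have "word_cong (lee_relations 2) (replace \<psi> u) (replace \<psi> v)" for \<psi>
    using e(2) unfolding lee2_basis_def lee2_cong_iff
    by (auto simp: lee2_zero_append)
  then show "e \<in> identities_of (lee_monoid 2)"
    using e(1) identities_of_lee_monoid_iff[of 2] by simp
qed

lemma deducible_context: "deducible \<Sigma> u v \<Longrightarrow> deducible \<Sigma> (p @ u @ q) (p @ v @ q)"
  by (intro deducible.mult deducible.refl)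

lemma lee2_delete:
  "deducible lee2_basis (p @ [x] @ h @ [x] @ k @ [x] @ q) (p @ [x] @ h @ k @ [x] @ q)"
proof -
  define \<sigma> where "\<sigma> i = (if i = 0 then [x] else if i = 2 then h else k)" for i :: nat
  have "deducible lee2_basis [0, 2, 0, 3, 0] [0, 2, 3, 0]"
    by (rule deducible.ax) (simp add: lee2_basis_def)
  from deducible_context[OF deducible.subst[OF this, of \<sigma>], of p q]
  show ?thesis by (simp add: subst_word_def \<sigma>_def)
qed

text \<open>The outer occurrences of \<open>x\<close> and \<open>y\<close> may come in either order;
  both orders are covered by reading a basis identity in both directions and exchanging the roles of
  \<open>x\<close> and \<open>y\<close>.\<close>

lemma lee2_swap:
  assumes "{x, y} \<subseteq> set p \<or> {x, y} \<subseteq> set q"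
  shows "deducible lee2_basis (p @ [y, x] @ q) (p @ [x, y] @ q)"
proof (cases "x = y")
  case False
  define \<sigma> where "\<sigma> x y h k i = (if i = 0 then [x] else if i = 1 then [y] else if i = 2 then h else k)"
    for x y and h k :: "nat list" and i :: nat
  have first: "deducible lee2_basis (p @ [x, y] @ h @ [x] @ k @ [y] @ q) (p @ [y, x] @ h @ [x] @ k @ [y] @ q)"
    for x y h k p q
  proof -
    have "deducible lee2_basis [0, 1, 2, 0, 3, 1] [1, 0, 2, 0, 3, 1]"
      by (rule deducible.ax) (simp add: lee2_basis_def)
    from deducible_context[OF deducible.subst[OF this, of "\<sigma> x y h k"], of p q]
    show ?thesis by (simp add: subst_word_def \<sigma>_def)
  qed
  have last: "deducible lee2_basis (p @ [x] @ h @ [y] @ k @ [x, y] @ q) (p @ [x] @ h @ [y] @ k @ [y, x] @ q)"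
    for x y h k p q
  proof -
    have "deducible lee2_basis [0, 2, 1, 3, 0, 1] [0, 2, 1, 3, 1, 0]"
      by (rule deducible.ax) (simp add: lee2_basis_def)
    from deducible_context[OF deducible.subst[OF this, of "\<sigma> x y h k"], of p q]
    show ?thesis by (simp add: subst_word_def \<sigma>_def)
  qed
  have split: "(\<exists>a b c. w = a @ [x] @ b @ [y] @ c) \<or> (\<exists>a b c. w = a @ [y] @ b @ [x] @ c)"
    if xy: "{x, y} \<subseteq> set w" for w
  proof -
    from xy obtain a b where w: "w = a @ x # b" by (meson insert_subset split_list)
    with xy False consider "y \<in> set a" | "y \<in> set b" by auto
    then show ?thesis
    proof cases
      case 1
      then show ?thesis using w by (fastforce dest: split_list)
    next
      case 2
      then show ?thesis using w by (fastforce dest: split_list)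
    qed
  qed
  from assms show ?thesis
  proof
    assume "{x, y} \<subseteq> set q"
    from split[OF this] show ?thesis
    proof (elim disjE exE)
      fix a b c assume "q = a @ [x] @ b @ [y] @ c"
      then show ?thesis using deducible.sym[OF first[of p x y a b c]] by simp
    next
      fix a b c assume "q = a @ [y] @ b @ [x] @ c"
      then show ?thesis using first[of p y x a b c] by simp
    qed
  next
    assume "{x, y} \<subseteq> set p"
    from split[OF this] show ?thesis
    proof (elim disjE exE)
      fix a b c assume "p = a @ [x] @ b @ [y] @ c"
      then show ?thesis using deducible.sym[OF last[of a x b y c q]] by simp
    next
      fix a b c assume "p = a @ [y] @ b @ [x] @ c"
      then show ?thesis using last[of a y b x c q] by simp
    qed
  qed
qed (simp add: deducible.refl)

lemma lee2_move:
  assumes "insert x (set p) \<subseteq> set c \<or> insert x (set p) \<subseteq> set q"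
  shows "deducible lee2_basis (c @ p @ [x] @ q) (c @ [x] @ p @ q)"
  using assms
proof (induction p arbitrary: q rule: rev_induct)
  case (snoc y p)
  have "deducible lee2_basis ((c @ p) @ [y, x] @ q) ((c @ p) @ [x, y] @ q)"
    by (rule lee2_swap) (use snoc.prems in auto)
  moreover have "deducible lee2_basis (c @ p @ [x] @ y # q) (c @ [x] @ p @ y # q)"
    by (rule snoc.IH) (use snoc.prems in auto)
  ultimately show ?case by (auto intro: deducible.trans)
qed (simp add: deducible.refl)

lemma count_list_ge_Suc_split:
  "count_list w x \<ge> Suc n \<Longrightarrow> \<exists>p q. w = p @ [x] @ q \<and> count_list q x \<ge> n"
proof -
  assume *: "count_list w x \<ge> Suc n"
  then have "x \<in> set w" by (metis count_notin not_less_eq_eq zero_le)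
  then obtain p q where "w = p @ x # q" "x \<notin> set p" by (meson split_list_first)
  with * show ?thesis by (intro exI[of _ p] exI[of _ q]) simp
qed

text \<open>A letter with three occurrences loses a middle one, which shortens the word.\<close>

lemma lee2_reduce: "\<exists>v. deducible lee2_basis w v \<and> (\<forall>x. count_list v x \<le> 2)"
proof (induction w rule: length_induct)
  case (1 w)
  show ?case
  proof (cases "\<forall>x. count_list w x \<le> 2")
    case False
    then obtain x where "count_list w x \<ge> Suc (Suc (Suc 0))" by (auto simp: not_le Suc_le_eq numeral_2_eq_2)
    then obtain p h k q where w: "w = p @ [x] @ h @ [x] @ k @ [x] @ q"
      by (blast dest: count_list_ge_Suc_split)
    then obtain v where "deducible lee2_basis (p @ [x] @ h @ k @ [x] @ q) v" "\<forall>x. count_list v x \<le> 2"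
      using 1[rule_format, of "p @ [x] @ h @ k @ [x] @ q"] by auto
    then show ?thesis
      unfolding w using lee2_delete deducible.trans by blast
  qed (blast intro: deducible.refl)
qed

text \<open>With all counts at most two, this and the set of letters recover every count from data
  that identities preserve.\<close>

lemma subseq_twice_iff: "subseq [x, x] w \<longleftrightarrow> 2 \<le> count_list w x"
proof (induction w)
  case (Cons c w)
  have "1 \<le> count_list w x \<longleftrightarrow> x \<in> set w"
    by (metis count_list_0_iff less_one not_less)
  then show ?case using Cons subseq2_append[of x x "[c]" w] by auto
qed simp

text \<open>The first letter of \<open>u\<close> can be moved to the front of \<open>v\<close>: the letters that it has to pass
  either all occur again later or have all occurred before.\<close>

lemma lee2_complete_reduced:
  assumes "(c @ u, c @ v) \<in> identities_of (lee_monoid 2)"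
    "\<forall>x. count_list (c @ u) x \<le> 2" "\<forall>x. count_list (c @ v) x \<le> 2"
  shows "deducible lee2_basis (c @ u) (c @ v)"
  using assms
proof (induction u arbitrary: c v)
  case Nil
  have count: "count_list c x = count_list (c @ v) x" for x
  proof -
    have "subseq [x, x] c \<longleftrightarrow> subseq [x, x] (c @ v)"
      using identity2_subseq_iff[OF Nil.prems(1)] by simp
    moreover have "count_list c x = 0 \<longleftrightarrow> count_list (c @ v) x = 0"
      using identity_set_eq[OF Nil.prems(1)] by (simp add: count_list_0_iff) auto
    ultimately show ?thesis
      using Nil.prems(2,3)[rule_format, of x] unfolding subseq_twice_iff by auto
  qed
  have "v = []"
  proof (cases v)
    case (Cons x v')
    then show ?thesis using count[of x] by simp
  qed
  then show ?case by (simp add: deducible.refl)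
next
  case (Cons x u)
  note id = Cons.prems(1)
  have count: "count_list (c @ x # u) y = count_list (c @ v) y" for y
  proof -
    have "subseq [y, y] (c @ x # u) \<longleftrightarrow> subseq [y, y] (c @ v)"
      using identity2_subseq_iff[OF id] by simp
    moreover have "count_list (c @ x # u) y = 0 \<longleftrightarrow> count_list (c @ v) y = 0"
      using identity_set_eq[OF id] unfolding count_list_0_iff by auto
    ultimately show ?thesis
      using Cons.prems(2,3)[rule_format, of y] unfolding subseq_twice_iff by linarith
  qed
  have "x \<in> set v"
    using count[of x] count_list_0_iff[of v x] by force
  then obtain p q where v: "v = p @ [x] @ q" "x \<notin> set p"
    using split_list_first[of x v] by auto
  have sub: "subseq [y, z] (c @ [x] @ u) \<longleftrightarrow> subseq [y, z] (c @ p @ [x] @ q)" for y z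
    using identity2_subseq_iff[OF id] v by simp
  have cnt: "count_list u y = count_list p y + count_list q y" for y
    using count[of y] v by (simp split: if_splits)
  have in_u: "y \<in> set u \<longleftrightarrow> y \<in> set p \<or> y \<in> set q" for y
    using cnt[of y] count_list_0_iff[of _ y] by (metis add_is_0)
  have le2: "count_list c y + count_list [x] y + count_list u y \<le> 2" for y
    using Cons.prems(2)[rule_format, of y] by (auto split: if_splits)
  have "deducible lee2_basis (c @ p @ [x] @ q) (c @ [x] @ p @ q)"
  proof (cases "x \<in> set c")
    \<comment> \<open>This is the last \<open>x\<close> in both words. A letter passed in
      \<open>p\<close> precedes it in \<open>c @ v\<close>, hence precedes an \<open>x\<close> in
      the other word too, which places it in \<open>c\<close>.\<close>
    case True
    then have "count_list c x \<noteq> 0" by (simp add: count_list_0_iff)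
    then have "x \<notin> set u"
      using le2[of x] count_list_0_iff[of u x] by fastforce
    then have "y \<in> set c" if "y \<in> set p" for y
      using that sub[of y x] in_u v subseq2_subset[of y x c] subseq2_subset[of y x u]
      by (auto simp: subseq2_append subseq_singleton_left split: if_splits)
    with True show ?thesis by (intro lee2_move) auto
  next
    case False
    \<comment> \<open>Here \<open>x\<close> is at its first occurrence. On the other side
      \<open>y\<close> follows it, so \<open>y\<close> must also follow it in
      \<open>c @ v\<close>.\<close>
    have q: "y \<in> set q" if "y \<in> set p" for y
    proof -
      have "subseq [x, y] (c @ [x] @ u)" using that in_u by (auto simp: subseq2_append subseq_singleton_left)
      then show ?thesis
        using False v sub[of x y] subseq2_subset[of x y c] subseq2_subset[of x y p]
          subseq2_subset[of x y q] by (auto simp: subseq2_append subseq_singleton_left)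
    qed
    show ?thesis
    proof (cases "x \<in> set q")
      case True
      with q show ?thesis by (intro lee2_move) auto
    next
      \<comment> \<open>Now \<open>x\<close> occurs only once. A letter of \<open>p\<close> would
        lie in \<open>c\<close> as well as in \<open>p\<close> and \<open>q\<close>, exceeding the
        bound of two, so there is nothing to pass.\<close>
      case notq: False
      have "y \<notin> set p" for y
      proof
        assume y: "y \<in> set p"
        then have "subseq [y, x] (c @ p @ [x] @ q)" by (auto simp: subseq2_append subseq_singleton_left)
        then have "y \<in> set c"
          using sub[of y x] notq v(2) in_u[of x] False subseq2_subset[of y x c] subseq2_subset[of y x u]
          by (auto simp: subseq2_append subseq_singleton_left split: if_splits)
        then have "count_list c y \<noteq> 0" "count_list p y \<noteq> 0" "count_list q y \<noteq> 0"
          using y q by (simp_all add: count_list_0_iff)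
        then show False using le2[of y] cnt[of y] by simp
      qed
      then show ?thesis by (cases p) (auto simp: deducible.refl)
    qed
  qed
  then have move: "deducible lee2_basis (c @ v) ((c @ [x]) @ p @ q)"
    using v by simp
  have "((c @ [x]) @ u, (c @ [x]) @ p @ q) \<in> identities_of (lee_monoid 2)"
    using identities_of_trans[OF id deducible_sound[OF move lee2_basis_identities]] by simp
  moreover have "count_list ((c @ [x]) @ u) y = count_list (c @ x # u) y"
    "count_list ((c @ [x]) @ p @ q) y = count_list (c @ v) y" for y
    using v by simp_all
  then have "\<forall>y. count_list ((c @ [x]) @ u) y \<le> 2" "\<forall>y. count_list ((c @ [x]) @ p @ q) y \<le> 2"
    using Cons.prems(2,3) by presburger+
  ultimately have "deducible lee2_basis ((c @ [x]) @ u) ((c @ [x]) @ p @ q)"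
    by (rule Cons.IH)
  then show ?case
    using deducible.trans[OF _ deducible.sym[OF move]] by simp
qed

theorem finitely_based_lee_monoid_2: "finitely_based (lee_monoid 2)"
  unfolding finitely_based_def
proof (intro exI[of _ lee2_basis] conjI ballI, goal_cases)
  case (3 e)
  obtain u v where e: "e = (u, v)" by (cases e)
  obtain u' v' where u': "deducible lee2_basis u u'" "\<forall>x. count_list u' x \<le> 2"
    and v': "deducible lee2_basis v v'" "\<forall>x. count_list v' x \<le> 2"
    using lee2_reduce by meson
  have "(u', u) \<in> identities_of (lee_monoid 2)" "(v, v') \<in> identities_of (lee_monoid 2)"
    using deducible_sound[OF deducible.sym[OF u'(1)] lee2_basis_identities]
      deducible_sound[OF v'(1) lee2_basis_identities] by simp_all
  with 3 e have "([] @ u', [] @ v') \<in> identities_of (lee_monoid 2)"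
    using identities_of_trans by (metis append_Nil)
  from lee2_complete_reduced[OF this] u' v' e show ?case
    by (auto intro: deducible.trans deducible.sym)
qed (simp_all add: lee2_basis_identities, simp add: lee2_basis_def)

section \<open>The identities for length at least three\<close>

lemma word_cong_join: "word_cong R u w \<Longrightarrow> word_cong R v w \<Longrightarrow> word_cong R u v"
  by (blast intro: word_cong.sym word_cong.trans)

abbreviation repeat :: "nat \<Rightarrow> 'b list \<Rightarrow> 'b list" where
  "repeat n w \<equiv> concat (replicate n w)"

text \<open>Each further copy of \<open>z\<close> supplies the next letter \<open>d\<close> of the
  alternating word. The letters skipped before it are neither \<open>Zero\<close> nor
  \<open>d\<close>, so the preceding letter absorbs them; for this the tail \<open>q\<close> is kept
  free of \<open>Zero\<close>.\<close>

lemma repeat_alternating: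
  assumes z: "Zero \<notin> set z" "A \<in> set z" "B \<in> set z"
  shows "\<exists>p q. Zero \<notin> set q \<and>
    word_cong (lee_relations l) (repeat n z) (p @ alternating_word n @ q)"
proof (induction n)
  case 0
  have "word_cong (lee_relations l) (repeat 0 z) ([] @ alternating_word 0 @ [])"
    by (simp add: alternating_word_def word_cong.refl)
  moreover have "Zero \<notin> set []" by simp
  ultimately show ?case by blast
next
  case (Suc n)
  let ?R = "lee_relations l"
  define d where "d = (if even n then A else B)"
  from Suc obtain p q where q: "Zero \<notin> set q"
    and n: "word_cong ?R (repeat n z) (p @ alternating_word n @ q)" by blast
  have "d \<in> set (q @ z)" using z by (simp add: d_def)
  then obtain q1 q2 where qz: "q @ z = q1 @ d # q2" "d \<notin> set q1"
    by (meson split_list_first)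
  have "Zero \<notin> set (q @ z)" using q z by simp
  then have Z: "Zero \<notin> set q1" "Zero \<notin> set q2" unfolding qz by auto
  have "repeat (Suc n) z = repeat n z @ z"
    by (simp flip: replicate_append_same)
  with word_cong_context(2)[OF n, of z] qz
  have 1: "word_cong ?R (repeat (Suc n) z) (p @ alternating_word n @ q1 @ d # q2)"
    by simp
  \<comment> \<open>For \<open>n = 0\<close> no preceding letter exists, and the skipped letters
    join \<open>p\<close> instead.\<close>
  have "\<exists>p'. word_cong ?R (p @ alternating_word n @ q1 @ d # q2) (p' @ alternating_word n @ d # q2)"
  proof (cases n)
    case 0
    have "word_cong ?R (p @ alternating_word n @ q1 @ d # q2) ((p @ q1) @ alternating_word n @ d # q2)"
      using 0 by (simp add: alternating_word_def word_cong.refl)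
    then show ?thesis by blast
  next
    case (Suc m)
    define e where "e = (if even m then A else B)"
    have "set (e # q1) \<subseteq> {e}"
    proof
      fix c assume "c \<in> set (e # q1)"
      then have "c = e \<or> (c \<noteq> Zero \<and> c \<noteq> d)" using Z qz(2) by auto
      then show "c \<in> {e}"
        using lee_gen.exhaust[of c "c = e"] by (auto simp: e_def d_def Suc split: if_splits)
    qed
    then have "word_cong ?R (e # q1) [e]"
      by (rule lee_cong_power) (auto simp: e_def)
    then have "word_cong ?R ((p @ alternating_word m) @ (e # q1) @ d # q2)
        ((p @ alternating_word m) @ [e] @ d # q2)"
      by (rule word_cong.mult)
    then show ?thesis
      by (auto simp: Suc alternating_word_Suc e_def intro!: exI[of _ p])
  qed
  then obtain p' where "word_cong ?R (repeat (Suc n) z) (p' @ alternating_word n @ d # q2)"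
    using 1 word_cong.trans by blast
  then have "word_cong ?R (repeat (Suc n) z) (p' @ alternating_word (Suc n) @ q2)"
    by (simp add: alternating_word_Suc d_def)
  with Z show ?case by blast
qed

lemma lee_cong_repeat_Zero:
  assumes "A \<in> set z" "B \<in> set z" "l \<ge> 1"
  shows "word_cong (lee_relations l) (p @ repeat l z @ q) [Zero]"
proof (cases "Zero \<in> set z")
  case True
  then show ?thesis using assms(3) by (intro lee_cong_Zero) auto
next
  case False
  then obtain p' q' where
    "word_cong (lee_relations l) (repeat l z) (p' @ alternating_word l @ q')"
    using repeat_alternating assms(1,2) by blast
  then have "word_cong (lee_relations l) (repeat l z) [Zero]"
    using lee_cong_alternating word_cong.trans by blast
  then have "word_cong (lee_relations l) (p @ repeat l z @ q) (p @ [Zero] @ q)"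
    by (rule word_cong.mult)
  moreover have "word_cong (lee_relations l) (p @ [Zero] @ q) [Zero]"
    by (rule lee_cong_Zero) simp
  ultimately show ?thesis by (rule word_cong.trans)
qed

text \<open>Once \<open>a\<close> has appeared it stays, by \<open>mono\<close>, and purity then
  excludes \<open>b\<close>. So blocks over \<open>b\<close>, some possibly empty, are followed by
  blocks over \<open>a\<close>, and each part collapses to one letter.\<close>

lemma lee_cong_run:
  assumes pure: "\<And>k. k \<le> n \<Longrightarrow> set (g k) \<subseteq> {a} \<or> set (g k) \<subseteq> {b}"
    and mono: "\<And>k. k < n \<Longrightarrow> a \<in> set (g k) \<Longrightarrow> a \<in> set (g (Suc k))"
    and ends: "b \<in> set (g 0)" "a \<in> set (g n)"
    and ab: "a \<noteq> b" "a \<noteq> Zero" "b \<noteq> Zero"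
  shows "word_cong (lee_relations l) (concat (map g [0..<Suc n])) [b, a]"
proof -
  let ?R = "lee_relations l"
  have 1: "word_cong ?R (concat (map g [0..<Suc m])) (if a \<in> set (g m) then [b, a] else [b])"
    if "m \<le> n" for m
    using that
  proof (induction m)
    case 0
    have "set (g 0) \<subseteq> {b}" using pure[of 0] ends ab by auto
    then have "word_cong ?R (g 0) [b]" using ends ab by (intro lee_cong_power) auto
    then show ?case using \<open>set (g 0) \<subseteq> {b}\<close> ab by auto
  next
    case (Suc m)
    let ?w = "if a \<in> set (g m) then [b, a] else [b]"
    have 1: "word_cong ?R (concat (map g [0..<Suc m]) @ g (Suc m)) (?w @ g (Suc m))"
      using Suc by (intro word_cong_context) auto
    moreover have "word_cong ?R (?w @ g (Suc m)) (if a \<in> set (g (Suc m)) then [b, a] else [b])"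
    proof (cases "a \<in> set (g (Suc m))")
      case True
      then have "set (g (Suc m)) \<subseteq> {a}" using pure[OF Suc.prems] ab by auto
      then have "word_cong ?R (g (Suc m)) [a]" "word_cong ?R (a # g (Suc m)) [a]"
        using True ab by (auto intro!: lee_cong_power)
      from word_cong_context(1)[OF this(1), of "[b]"] word_cong_context(1)[OF this(2), of "[b]"]
      show ?thesis using True by simp
    next
      case False
      then have "a \<notin> set (g m)" using mono Suc.prems by auto
      moreover have "set (b # g (Suc m)) \<subseteq> {b}" using pure[OF Suc.prems] False
        by (cases "g (Suc m)") auto
      then have "word_cong ?R (b # g (Suc m)) [b]"
        using ab by (intro lee_cong_power) auto
      ultimately show ?thesis using False by simp
    qed
    ultimately show ?case using word_cong.trans by fastforce
  qed
  from this[of n] ends show ?thesis by simp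
qed

text \<open>The letters \<open>0, \<dots>, 2 * N\<close> form a path. A stage is a set of pairwise nonadjacent letters,
  and every pair of nonadjacent letters of different parity occurs in some stage. Along the list of
  stages, the odd letters replace the even ones from left to right, and are then replaced again by
  the even ones from left to right.\<close>

definition odd_rise :: "nat \<Rightarrow> nat \<Rightarrow> nat list" where
  "odd_rise N k = filter (\<lambda>c. if even c then 2 * k \<le> c else c + 2 < 2 * k) [0..<2 * N + 1]"

definition even_rise :: "nat \<Rightarrow> nat \<Rightarrow> nat list" where
  "even_rise N k = filter (\<lambda>c. if even c then c < 2 * k else 2 * k < c) [0..<2 * N + 1]"

text \<open>In stage \<open>k\<close> the odd letters are at most \<open>2 * k - 3\<close> and the
  even ones at least \<open>2 * k\<close> during the first half; in the second half the even ones
  are at most \<open>2 * k - 2\<close> and the odd ones at least \<open>2 * k + 1\<close>. The gap 3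
  is the least odd distance between nonadjacent letters. At \<open>k = 0\<close> and
  \<open>k = N + 1\<close> exactly one parity is present, in full.\<close>

definition stages :: "nat \<Rightarrow> nat list list" where
  "stages N = map (odd_rise N) [0..<Suc (N + 1)] @ map (even_rise N) [0..<Suc (N + 1)]"

definition zig :: "nat \<Rightarrow> nat \<Rightarrow> nat list" where
  "zig l N = concat (map (repeat l) (stages N))"

definition zag :: "nat \<Rightarrow> nat \<Rightarrow> nat list" where
  "zag l N = concat (map (repeat l) (rev (stages N)))"

lemma set_odd_rise: "set (odd_rise N k) = {c. c \<le> 2 * N \<and> (if even c then 2 * k \<le> c else c + 2 < 2 * k)}"
  by (auto simp: odd_rise_def less_Suc_eq_le simp del: upt_Suc)

lemma set_even_rise: "set (even_rise N k) = {c. c \<le> 2 * N \<and> (if even c then c < 2 * k else 2 * k < c)}"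
  by (auto simp: even_rise_def less_Suc_eq_le simp del: upt_Suc)

lemma replace_concat: "replace \<psi> (concat ws) = concat (map (replace \<psi>) ws)"
  by (induction ws) auto

lemma rev_upt_Suc: "rev [0..<Suc n] = map (\<lambda>k. n - k) [0..<Suc n]"
  by (rule nth_equalityI) (auto simp: rev_nth simp del: upt_Suc)

lemma set_zag: "l \<ge> 1 \<Longrightarrow> set (zag l N) = set (zig l N)"
  by (auto simp: zig_def zag_def)

lemma set_zig: "l \<ge> 1 \<Longrightarrow> set (zig l N) = {..2 * N}"
proof
  assume l: "l \<ge> 1"
  show "set (zig l N) \<subseteq> {..2 * N}"
    by (auto simp: zig_def stages_def set_odd_rise set_even_rise)
  show "{..2 * N} \<subseteq> set (zig l N)"
  proof
    fix c assume "c \<in> {..2 * N}"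
    then have "c \<in> set (odd_rise N 0) \<or> c \<in> set (even_rise N 0)"
      by (auto simp: set_odd_rise set_even_rise intro: Nat.gr0I)
    moreover have "odd_rise N 0 \<in> set (stages N)" "even_rise N 0 \<in> set (stages N)"
      by (auto simp: stages_def simp del: upt_Suc)
    ultimately show "c \<in> set (zig l N)"
      using l by (auto simp: zig_def)
  qed
qed

section \<open>The identity \<open>zig = zag\<close>\<close>

lemma zig_zag_Zero:
  assumes "S \<in> set (stages N)" "A \<in> set (replace \<psi> S)" "B \<in> set (replace \<psi> S)" "l \<ge> 1"
  shows "word_cong (lee_relations l) (replace \<psi> (zig l N)) [Zero]"
    "word_cong (lee_relations l) (replace \<psi> (zag l N)) [Zero]"
proof -
  have "word_cong (lee_relations l) (replace \<psi> (concat (map (repeat l) ws))) [Zero]"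
    if S: "S \<in> set ws" for ws
  proof -
    obtain us vs where "ws = us @ S # vs" using S by (meson split_list)
    then show ?thesis
      using lee_cong_repeat_Zero[OF assms(2-4), of "replace \<psi> (concat (map (repeat l) us))"
          "replace \<psi> (concat (map (repeat l) vs))"]
      by (simp add: replace_concat[of \<psi> "replicate l S"])
  qed
  then show "word_cong (lee_relations l) (replace \<psi> (zig l N)) [Zero]"
    "word_cong (lee_relations l) (replace \<psi> (zag l N)) [Zero]"
    using assms(1) by (simp_all add: zig_def zag_def)
qed

text \<open>Each half of the stages is a run in the sense of \<open>lee_cong_run\<close>: first from
  \<open>b\<close> to \<open>a\<close>, then back. Reversing the list exchanges the halves and
  reverses each of them, which gives the same shape \<open>ba\<close> times
  \<open>ab\<close>.\<close>

lemma zig_zag_nonzero: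
  assumes l: "l \<ge> 1"
    and even: "\<And>c. c \<le> 2 * N \<Longrightarrow> even c \<Longrightarrow> set (\<psi> c) \<subseteq> {b}"
    and odd: "\<And>c. c \<le> 2 * N \<Longrightarrow> odd c \<Longrightarrow> set (\<psi> c) \<subseteq> {a}"
    and ex_even: "\<exists>c\<le>2 * N. even c \<and> \<psi> c \<noteq> []"
    and ex_odd: "\<exists>c\<le>2 * N. odd c \<and> \<psi> c \<noteq> []"
    and pure: "\<And>S. S \<in> set (stages N) \<Longrightarrow> set (replace \<psi> S) \<subseteq> {a} \<or> set (replace \<psi> S) \<subseteq> {b}"
    and ab: "a \<noteq> b" "a \<noteq> Zero" "b \<noteq> Zero"
  shows "word_cong (lee_relations l) (replace \<psi> (zig l N)) [b, a, b]"
    "word_cong (lee_relations l) (replace \<psi> (zag l N)) [b, a, b]"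
proof -
  let ?R = "lee_relations l"
  define g where "g k = replace \<psi> (repeat l (odd_rise N k))" for k
  define h where "h k = replace \<psi> (repeat l (even_rise N k))" for k
  have set_g: "set (g k) = set (replace \<psi> (odd_rise N k))" for k
    using l by (auto simp: g_def)
  have set_h: "set (h k) = set (replace \<psi> (even_rise N k))" for k
    using l by (auto simp: h_def)
  have pure_g: "set (g k) \<subseteq> {a} \<or> set (g k) \<subseteq> {b}" if "k \<le> N + 1" for k
    unfolding set_g by (rule pure) (use that in \<open>auto simp: stages_def simp del: upt_Suc\<close>)
  have pure_h: "set (h k) \<subseteq> {a} \<or> set (h k) \<subseteq> {b}" if "k \<le> N + 1" for k
    unfolding set_h by (rule pure) (use that in \<open>auto simp: stages_def simp del: upt_Suc\<close>)
  have a_odd: "odd c" if "a \<in> set (\<psi> c)" "c \<le> 2 * N" for c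
    using even[of c] that ab by auto
  have b_even: "even c" if "b \<in> set (\<psi> c)" "c \<le> 2 * N" for c
    using odd[of c] that ab by auto
  \<comment> \<open>Monotonicity is recorded in both directions: \<open>a_g\<close> and
    \<open>b_h\<close> serve \<open>zig\<close>, while \<open>a_h\<close> and \<open>b_g\<close>
    serve the reversed runs of \<open>zag\<close>.\<close>
  have a_g: "a \<in> set (g j)" if "a \<in> set (g k)" "k \<le> j" for j k
    using that a_odd by (fastforce simp: set_g set_odd_rise)
  have b_g: "b \<in> set (g j)" if "b \<in> set (g k)" "j \<le> k" for j k
    using that b_even by (fastforce simp: set_g set_odd_rise)
  have a_h: "a \<in> set (h j)" if "a \<in> set (h k)" "j \<le> k" for j k
    using that a_odd by (fastforce simp: set_h set_even_rise)
  have b_h: "b \<in> set (h j)" if "b \<in> set (h k)" "k \<le> j" for j k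
    using that b_even by (fastforce simp: set_h set_even_rise)
  obtain c where c: "c \<le> 2 * N" "Parity.even c" "b \<in> set (\<psi> c)"
  proof -
    from ex_even obtain c where c: "c \<le> 2 * N" "Parity.even c" "\<psi> c \<noteq> []" by blast
    then have "b \<in> set (\<psi> c)" using even[of c] by (cases "\<psi> c") auto
    with c show ?thesis using that by blast
  qed
  obtain d where d: "d \<le> 2 * N" "Parity.odd d" "a \<in> set (\<psi> d)"
  proof -
    from ex_odd obtain d where d: "d \<le> 2 * N" "Parity.odd d" "\<psi> d \<noteq> []" by blast
    then have "a \<in> set (\<psi> d)" using odd[of d] by (cases "\<psi> d") auto
    with d show ?thesis using that by blast
  qed
  have d': "d + 2 < 2 * (N + 1)" "0 < d" using d by (auto elim!: oddE) presburger
  have ends: "b \<in> set (g 0)" "a \<in> set (g (N + 1))" "a \<in> set (h 0)" "b \<in> set (h (N + 1))"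
    using c d d' by (fastforce simp: set_g set_h set_odd_rise set_even_rise)+
  have 1: "word_cong ?R (concat (map g [0..<Suc (N + 1)])) [b, a]"
    by (rule lee_cong_run) (use pure_g a_g ends ab in \<open>auto\<close>)
  have 2: "word_cong ?R (concat (map h [0..<Suc (N + 1)])) [a, b]"
    by (rule lee_cong_run) (use pure_h b_h ends ab in auto)
  have zig: "word_cong ?R (replace \<psi> (zig l N)) ([b, a] @ [a, b])"
    using word_cong_append[OF 1 2]
    by (simp add: zig_def stages_def replace_concat[of \<psi> "map _ _"] g_def[abs_def] h_def[abs_def] comp_def del: upt_Suc)
  have 3: "word_cong ?R (concat (map (\<lambda>k. h (N + 1 - k)) [0..<Suc (N + 1)])) [b, a]"
    by (rule lee_cong_run, rule pure_h) (use a_h ends ab in auto)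
  have 4: "word_cong ?R (concat (map (\<lambda>k. g (N + 1 - k)) [0..<Suc (N + 1)])) [a, b]"
    by (rule lee_cong_run, rule pure_g[THEN disj_commute[THEN iffD1]]) (use b_g ends ab in auto)
  have zag: "word_cong ?R (replace \<psi> (zag l N)) ([b, a] @ [a, b])"
    using word_cong_append[OF 3 4]
    by (simp add: zag_def stages_def rev_map rev_upt_Suc replace_concat[of \<psi> "map _ _"] g_def[abs_def] h_def[abs_def] comp_def del: upt_Suc)
  have "word_cong ?R ([b] @ [a, a] @ [b]) ([b] @ [a] @ [b])"
    using ab by (intro word_cong.mult lee_cong_idem)
  with zig zag show "word_cong ?R (replace \<psi> (zig l N)) [b, a, b]"
    "word_cong ?R (replace \<psi> (zag l N)) [b, a, b]"
    by (auto intro: word_cong.trans)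
qed

text \<open>If \<open>Zero\<close> occurs or some stage receives both generators, both words vanish.
  Otherwise each parity class, being itself a stage, goes to powers of one generator. If a single
  generator is left, both words are powers of it or empty; if not, \<open>zig_zag_nonzero\<close>
  applies.\<close>

lemma zig_zag_identity:
  assumes l: "l \<ge> 1"
  shows "(zig l N, zag l N) \<in> identities_of (lee_monoid l)"
proof -
  have "word_cong (lee_relations l) (replace \<psi> (zig l N)) (replace \<psi> (zag l N))" for \<psi>
  proof -
    have set_eq: "set (replace \<psi> (zag l N)) = set (replace \<psi> (zig l N))"
      using set_zag[OF l] by simp
    consider (zero) "Zero \<in> set (replace \<psi> (zig l N))"
      | (mixed) S where "S \<in> set (stages N)" "A \<in> set (replace \<psi> S)" "B \<in> set (replace \<psi> S)"
      | (pure) "Zero \<notin> set (replace \<psi> (zig l N))"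
          "\<And>S. S \<in> set (stages N) \<Longrightarrow> A \<notin> set (replace \<psi> S) \<or> B \<notin> set (replace \<psi> S)"
      by blast
    then show ?thesis
    proof cases
      case zero
      then show ?thesis
        unfolding set_eq[symmetric]
        by (intro word_cong_join[OF lee_cong_Zero lee_cong_Zero]) (simp_all only: set_eq)
    next
      case mixed
      then show ?thesis
        using word_cong_join[OF zig_zag_Zero[OF mixed l]] by blast
    next
      case pure
      have pure': "set (replace \<psi> S) \<subseteq> {A} \<or> set (replace \<psi> S) \<subseteq> {B}"
        if "S \<in> set (stages N)" for S
      proof -
        have "set (replace \<psi> S) \<subseteq> set (replace \<psi> (zig l N))"
          using that l by (auto simp: zig_def)
        then have "c = A \<or> c = B" if "c \<in> set (replace \<psi> S)" for c
          using that pure(1) lee_gen.exhaust[of c "c = A \<or> c = B"] by blast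
        then show ?thesis using pure(2)[OF that] by blast
      qed
      \<comment> \<open>These two stages consist of all even and of all odd letters,
        respectively.\<close>
      have "odd_rise N 0 \<in> set (stages N)" "even_rise N 0 \<in> set (stages N)"
        by (auto simp: stages_def simp del: upt_Suc)
      from this[THEN pure'] obtain a b where
        a: "a \<in> {A, B}" "set (replace \<psi> (even_rise N 0)) \<subseteq> {a}" and
        b: "b \<in> {A, B}" "set (replace \<psi> (odd_rise N 0)) \<subseteq> {b}" by blast
      have odd: "set (\<psi> c) \<subseteq> {a}" if "c \<le> 2 * N" "odd c" for c
      proof -
        have "0 < c" using that by (auto intro: Nat.gr0I)
        then have "c \<in> set (even_rise N 0)" using that by (simp add: set_even_rise)
        then show ?thesis using a(2) by auto
      qed
      have even: "set (\<psi> c) \<subseteq> {b}" if "c \<le> 2 * N" "even c" for c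
      proof -
        have "c \<in> set (odd_rise N 0)" using that by (simp add: set_odd_rise)
        then show ?thesis using b(2) by auto
      qed
      show ?thesis
      proof (cases "\<exists>c. c \<noteq> Zero \<and> set (replace \<psi> (zig l N)) \<subseteq> {c}")
        case True
        then obtain c where c: "c \<noteq> Zero" "set (replace \<psi> (zig l N)) \<subseteq> {c}" by blast
        show ?thesis
        proof (cases "replace \<psi> (zig l N) = []")
          case True
          then have "replace \<psi> (zag l N) = []" using set_eq by (simp only: list.set set_empty)
          with True word_cong.refl[of _ "[]"] show ?thesis by (simp only:)
        next
          case False
          then have ne: "replace \<psi> (zag l N) \<noteq> []" using set_eq by (metis set_empty)
          have "set (replace \<psi> (zag l N)) \<subseteq> {c}" unfolding set_eq by (rule c(2))
          then show ?thesis
            using word_cong_join[OF lee_cong_power[OF c(2) False c(1)] lee_cong_power[OF _ ne c(1)]]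
            by blast
        qed
      next
        case False
        have U: "set (replace \<psi> (zig l N)) = (\<Union>c\<in>{..2 * N}. set (\<psi> c))"
          using set_zig[OF l] by simp
        have nz: "a \<noteq> Zero" "b \<noteq> Zero" using a b by auto
        have ne: "a \<noteq> b"
        proof
          assume "a = b"
          then have "set (replace \<psi> (zig l N)) \<subseteq> {a}" unfolding U using odd even by blast
          with False nz show False by blast
        qed
        have "\<exists>c\<le>2 * N. Parity.even c \<and> \<psi> c \<noteq> []"
        proof (rule ccontr)
          assume "\<not> ?thesis"
          then have "set (replace \<psi> (zig l N)) \<subseteq> {a}" unfolding U using odd by fastforce
          with False nz show False by blast
        qed
        moreover have "\<exists>c\<le>2 * N. Parity.odd c \<and> \<psi> c \<noteq> []"
        proof (rule ccontr)
          assume "\<not> ?thesis"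
          then have "set (replace \<psi> (zig l N)) \<subseteq> {b}" unfolding U using even by fastforce
          with False nz show False by blast
        qed
        moreover have "set (replace \<psi> S) \<subseteq> {a} \<or> set (replace \<psi> S) \<subseteq> {b}"
          if "S \<in> set (stages N)" for S
          using pure'[OF that] a(1) b(1) ne by auto
        ultimately show ?thesis
          using l odd even ne nz
          by (intro word_cong_join[OF zig_zag_nonzero[of l N \<psi> b a]])
      qed
    qed
  qed
  then show ?thesis using l by (simp add: identities_of_lee_monoid_iff)
qed

section \<open>An invariant for all \<open>l \<ge> 3\<close>\<close>

text \<open>Describes the words that are 0 in \<open>L_3\<close>. Since \<open>L_3\<close> is a
  quotient of \<open>L_l\<close> for \<open>l \<ge> 3\<close>, one predicate serves all these
  \<open>l\<close>.\<close>

definition lee3_zero :: "lee_gen list \<Rightarrow> bool" where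
  "lee3_zero w \<longleftrightarrow> Zero \<in> set w \<or> subseq [A, B, A] w"

lemma subseq_ABA_alternating:
  assumes "l \<ge> 3"
  shows "subseq [A, B, A] (alternating_word l)"
proof -
  have "[0..<l] = [0, 1, 2] @ [3..<l]"
    using assms by (simp add: upt_conv_Cons numeral_2_eq_2 numeral_3_eq_3)
  then show ?thesis by (simp add: alternating_word_def)
qed

lemma lee3_cong_invariant:
  assumes "word_cong (lee_relations l) u v" "l \<ge> 3"
  shows "lee3_zero u \<longleftrightarrow> lee3_zero v"
proof -
  \<comment> \<open>The letters and two-letter subsequences decide which contexts make a word
    vanish, so the induction has to preserve them too.\<close>
  have "(lee3_zero u \<longleftrightarrow> lee3_zero v) \<and> (\<not> lee3_zero u \<longrightarrow> set u = set v \<and>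
      (subseq [A, B] u \<longleftrightarrow> subseq [A, B] v) \<and> (subseq [B, A] u \<longleftrightarrow> subseq [B, A] v))"
    using assms(1)
  proof induction
    case (rel u v)
    then show ?case
      using subseq_ABA_alternating[OF assms(2)]
      by (auto simp: lee_relations_def) (auto simp: lee3_zero_def)
  next
    case (mult u v p q)
    then show ?case
      by (auto simp: lee3_zero_def subseq2_append subseq3_append)
  qed auto
  then show ?thesis by blast
qed

definition two_letters :: "nat set \<Rightarrow> nat set \<Rightarrow> nat \<Rightarrow> lee_gen list" where
  "two_letters X Y c = (if c \<in> X then [A] else if c \<in> Y then [B] else [])"

lemma lee3_zero_two_letters:
  assumes "X \<inter> Y = {}"
  shows "lee3_zero (replace (two_letters X Y) w) \<longleftrightarrow>
    (\<exists>x\<in>X. \<exists>y\<in>Y. \<exists>z\<in>X. subseq [x, y, z] w)"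
proof -
  let ?r = "replace (two_letters X Y)"
  have Zero: "Zero \<notin> set (?r w)"
    by (auto simp: two_letters_def)
  have A: "A \<in> set (?r w) \<longleftrightarrow> (\<exists>x\<in>X. x \<in> set w)" for w
    by (auto simp: two_letters_def)
  have BA: "subseq [B, A] (?r w) \<longleftrightarrow> (\<exists>y\<in>Y. \<exists>z\<in>X. subseq [y, z] w)" for w
  proof (induction w)
    case (Cons c w)
    have "subseq [y, z] (c # w) \<longleftrightarrow> subseq [y, z] w \<or> (y = c \<and> z \<in> set w)" for y z
      using subseq2_append[of y z "[c]" w] by auto
    then have "(\<exists>y\<in>Y. \<exists>z\<in>X. subseq [y, z] (c # w)) \<longleftrightarrow>
        (\<exists>y\<in>Y. \<exists>z\<in>X. subseq [y, z] w) \<or> (c \<in> Y \<and> (\<exists>z\<in>X. z \<in> set w))"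
      by (simp only:) blast
    moreover have "subseq [B, A] (?r (c # w)) \<longleftrightarrow> subseq [B, A] (?r w) \<or> (c \<in> Y \<and> A \<in> set (?r w))"
      using assms subseq2_append[of B A "two_letters X Y c" "?r w"] subseq2_subset[of B A "?r w"]
      by (auto simp: two_letters_def)
    ultimately show ?case by (simp only: Cons A)
  qed simp
  have "subseq [A, B, A] (?r w) \<longleftrightarrow> (\<exists>x\<in>X. \<exists>y\<in>Y. \<exists>z\<in>X. subseq [x, y, z] w)"
  proof (induction w)
    case (Cons c w)
    have "subseq [x, y, z] (c # w) \<longleftrightarrow> subseq [x, y, z] w \<or> (x = c \<and> subseq [y, z] w)" for x y z
      using subseq3_append[of x y z "[c]" w] by auto
    then have "(\<exists>x\<in>X. \<exists>y\<in>Y. \<exists>z\<in>X. subseq [x, y, z] (c # w)) \<longleftrightarrow>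
        (\<exists>x\<in>X. \<exists>y\<in>Y. \<exists>z\<in>X. subseq [x, y, z] w) \<or> (c \<in> X \<and> (\<exists>y\<in>Y. \<exists>z\<in>X. subseq [y, z] w))"
      by (simp only:) blast
    moreover have "subseq [A, B, A] (?r (c # w)) \<longleftrightarrow>
        subseq [A, B, A] (?r w) \<or> (c \<in> X \<and> subseq [B, A] (?r w))"
      using subseq3_append[of A B A "two_letters X Y c" "?r w"]
      by (auto simp: two_letters_def)
    ultimately show ?case by (simp only: Cons BA)
  qed simp
  with Zero show ?thesis by (simp add: lee3_zero_def)
qed

text \<open>The right side keeps the image of \<open>u\<close> as a word, so that for
  \<open>zig\<close> it can be computed by congruence instead of by searching for
  subsequences.\<close>

lemma identity3_two_letters:
  assumes "(u, v) \<in> identities_of (lee_monoid l)" "l \<ge> 3" "X \<inter> Y = {}"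
  shows "(\<exists>x\<in>X. \<exists>y\<in>Y. \<exists>z\<in>X. subseq [x, y, z] v) \<longleftrightarrow>
    lee3_zero (replace (two_letters X Y) u)"
proof -
  have "word_cong (lee_relations l) (replace (two_letters X Y) u) (replace (two_letters X Y) v)"
    using assms identities_of_lee_monoid_iff[of l] by simp
  then show ?thesis
    using lee3_cong_invariant assms(2) lee3_zero_two_letters[OF assms(3)] by blast
qed

section \<open>Words identified with \<open>zig\<close>\<close>

text \<open>Send \<open>e\<close> to \<open>B\<close> and its neighbours to \<open>A\<close>. No
  stage contains \<open>e\<close> together with a neighbour, so \<open>zig\<close> becomes
  \<open>bab\<close>, which is not zero in the sense of \<open>lee3_zero\<close>.\<close>

lemma zig_class_adjacent:
  assumes w: "(zig l N, w) \<in> identities_of (lee_monoid l)"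
    and l: "l \<ge> 3" and N: "N \<ge> 1" and e: "even e" "e \<le> 2 * N"
    and xz: "x = Suc e \<or> Suc x = e" "z = Suc e \<or> Suc z = e"
  shows "\<not> subseq [x, e, z] w"
proof
  let ?X = "{c. c = Suc e \<or> Suc c = e}"
  let ?\<psi> = "two_letters ?X {e}"
  assume "subseq [x, e, z] w"
  then have zero: "lee3_zero (replace ?\<psi> (zig l N))"
    using xz by (subst identity3_two_letters[OF w l, symmetric]) auto
  have "word_cong (lee_relations l) (replace ?\<psi> (zig l N)) [B, A, B]"
  proof (rule zig_zag_nonzero)
    show "\<exists>c\<le>2 * N. even c \<and> ?\<psi> c \<noteq> []"
      using e by (intro exI[of _ e]) (simp add: two_letters_def)
    \<comment> \<open>The predecessor of \<open>e\<close> serves, except for \<open>e = 0\<close>,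
      where the neighbour 1 lies on the path because \<open>N \<ge> 1\<close>.\<close>
    show "\<exists>c\<le>2 * N. odd c \<and> ?\<psi> c \<noteq> []"
    proof (cases e)
      case 0
      then show ?thesis using N by (intro exI[of _ 1]) (simp add: two_letters_def)
    next
      case (Suc d)
      then show ?thesis using e by (intro exI[of _ d]) (simp add: two_letters_def)
    qed
    fix S assume "S \<in> set (stages N)"
    then have "e \<notin> set S \<or> set S \<inter> ?X = {}"
      using e unfolding stages_def
      by (auto simp: set_odd_rise set_even_rise simp del: upt_Suc split: if_splits)
    then show "set (replace ?\<psi> S) \<subseteq> {A} \<or> set (replace ?\<psi> S) \<subseteq> {B}"
      by (auto simp: two_letters_def)
  qed (use l e in \<open>auto simp: two_letters_def\<close>)
  then have "lee3_zero [B, A, B]"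
    using zero lee3_cong_invariant l by blast
  then show False by (simp add: lee3_zero_def)
qed

text \<open>Some stage contains both letters, so sending them to \<open>A\<close> and
  \<open>B\<close> makes \<open>zig\<close> vanish.\<close>

lemma zig_class_nonadjacent:
  assumes w: "(zig l N, w) \<in> identities_of (lee_monoid l)"
    and l: "l \<ge> 3" and e: "even e" "e \<le> 2 * N" and i: "odd i" "i \<le> 2 * N"
    and na: "i \<noteq> Suc e" "Suc i \<noteq> e"
  shows "subseq [i, e, i] w"
proof -
  let ?\<psi> = "two_letters {i} {e}"
  have "i \<noteq> e" using e i by auto
  have "\<exists>S\<in>set (stages N). e \<in> set S \<and> i \<in> set S"
  \<comment> \<open>By parity the letters are at least three apart. The stage chosen is the one
    where \<open>e\<close> is the smallest even letter if \<open>i < e\<close>, and the largest one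
    otherwise.\<close>
  proof (cases "i < e")
    case True
    have "i + 2 < e" using True e(1) i(1) na by presburger
    then have "e \<in> set (odd_rise N (e div 2))" "i \<in> set (odd_rise N (e div 2))"
      using e i by (auto simp: set_odd_rise)
    moreover have "odd_rise N (e div 2) \<in> set (stages N)"
      using e by (auto simp: stages_def simp del: upt_Suc)
    ultimately show ?thesis by blast
  next
    case False
    have "e + 2 < i" using False e(1) i(1) na by presburger
    then have "e \<in> set (even_rise N (e div 2 + 1))" "i \<in> set (even_rise N (e div 2 + 1))"
      using e i by (auto simp: set_even_rise)
    moreover have "even_rise N (e div 2 + 1) \<in> set (stages N)"
      using e by (auto simp: stages_def simp del: upt_Suc)
    ultimately show ?thesis by blast
  qed
  then obtain S where S: "S \<in> set (stages N)" "e \<in> set S" "i \<in> set S" by blast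
  then have "A \<in> set (replace ?\<psi> S)" "B \<in> set (replace ?\<psi> S)"
    using \<open>i \<noteq> e\<close> by (auto simp: two_letters_def intro!: bexI)
  from zig_zag_Zero(1)[OF S(1) this] l
  have "word_cong (lee_relations l) (replace ?\<psi> (zig l N)) [Zero]" by simp
  moreover have "lee3_zero [Zero]" by (simp add: lee3_zero_def)
  ultimately have "lee3_zero (replace ?\<psi> (zig l N))"
    using lee3_cong_invariant l by blast
  then show ?thesis
    using identity3_two_letters[OF w l, of "{i}" "{e}"] \<open>i \<noteq> e\<close> by auto
qed

lemma subseq3_nth:
  "subseq [x, y, z] w \<longleftrightarrow>
    (\<exists>a b c. a < b \<and> b < c \<and> c < length w \<and> w ! a = x \<and> w ! b = y \<and> w ! c = z)"
proof
  assume "subseq [x, y, z] w"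
  then obtain p v where w: "w = p @ x # v" "subseq [y, z] v"
    using list_emb_ConsD[of "(=)" x "[y, z]" w] by auto
  then obtain q r where v: "v = q @ y # r" "z \<in> set r"
    using list_emb_ConsD[of "(=)" y "[z]" v] by (auto simp: subseq_singleton_left)
  from v(2) obtain k where k: "k < length r" "r ! k = z" by (auto simp: in_set_conv_nth)
  show "\<exists>a b c. a < b \<and> b < c \<and> c < length w \<and> w ! a = x \<and> w ! b = y \<and> w ! c = z"
  proof (intro exI conjI)
    show "length p < length p + 1 + length q" by simp
    show "length p + 1 + length q < length p + 1 + length q + 1 + k" by simp
  qed (use k in \<open>simp_all add: w(1) v(1) nth_append\<close>)
next
  assume "\<exists>a b c. a < b \<and> b < c \<and> c < length w \<and> w ! a = x \<and> w ! b = y \<and> w ! c = z"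
  then obtain a b c where abc: "a < b" "b < c" "c < length w" "w ! a = x" "w ! b = y" "w ! c = z"
    by blast
  then have "w = take b w @ [y] @ drop (Suc b) w"
    using id_take_nth_drop[of b w] by simp
  moreover have "x \<in> set (take b w)"
    using abc by (auto simp: in_set_conv_nth intro!: exI[of _ a])
  moreover have "z \<in> set (drop (Suc b) w)"
    using abc by (auto simp: in_set_conv_nth intro!: exI[of _ "c - Suc b"])
  ultimately show "subseq [x, y, z] w"
    using subseq3_append[of x y z "take b w" "[y] @ drop (Suc b) w"]
      subseq2_append[of y z "[y]" "drop (Suc b) w"] by auto
qed

lemma subseq3_subset: "subseq [x, y, z] w \<Longrightarrow> x \<in> set w \<and> y \<in> set w \<and> z \<in> set w"
  using list_emb_set[of "(=)" "[x, y, z]" w] by auto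

text \<open>In a word identified with \<open>zig\<close>, for \<open>j + 2 \<le> N\<close>, this
  forces \<open>2 * j + 1\<close> to occur before every \<open>2 * j + 3\<close>: the letter
  \<open>2 * j + 4\<close> is adjacent to \<open>2 * j + 3\<close> and cannot lie between two of its
  occurrences.\<close>

definition rising :: "nat \<Rightarrow> nat list \<Rightarrow> bool" where
  "rising j w \<longleftrightarrow> subseq [2 * j + 1, 2 * j + 4, 2 * j + 3] w"

text \<open>Below, \<open>x\<close>, \<open>y\<close>, \<open>z\<close> are consecutive odd letters, and \<open>d\<close>, \<open>e\<close>, \<open>f\<close> are the even letters
  following \<open>x\<close>, \<open>y\<close>, \<open>z\<close> on the path.\<close>

lemma subseq3_orientation:
  assumes d: "\<And>p q. p \<in> {x, y} \<Longrightarrow> q \<in> {x, y} \<Longrightarrow> \<not> subseq [p, d, q] w"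
    and e: "\<And>p q. p \<in> {y, z} \<Longrightarrow> q \<in> {y, z} \<Longrightarrow> \<not> subseq [p, e, q] w"
    and f: "\<not> subseq [z, f, z] w"
    and inside: "subseq [x, e, x] w" "subseq [y, f, y] w" "subseq [z, d, z] w"
  shows "subseq [x, e, y] w \<longleftrightarrow> subseq [y, f, z] w"
proof -
  have D: False if "a < b" "b < c" "c < length w" "w ! b = d" "w ! a \<in> {x, y}" "w ! c \<in> {x, y}" for a b c
    using d[OF that(5,6)] that unfolding subseq3_nth by blast
  have E: False if "a < b" "b < c" "c < length w" "w ! b = e" "w ! a \<in> {y, z}" "w ! c \<in> {y, z}" for a b c
    using e[OF that(5,6)] that unfolding subseq3_nth by blast
  have F: False if "a < b" "b < c" "c < length w" "w ! b = f" "w ! a = z" "w ! c = z" for a b c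
    using f that unfolding subseq3_nth by blast
  obtain x1 e1 x2 where x: "x1 < e1" "e1 < x2" "x2 < length w" "w ! x1 = x" "w ! e1 = e" "w ! x2 = x"
    using inside(1) unfolding subseq3_nth by blast
  obtain y1 f1 y2 where y: "y1 < f1" "f1 < y2" "y2 < length w" "w ! y1 = y" "w ! f1 = f" "w ! y2 = y"
    using inside(2) unfolding subseq3_nth by blast
  obtain z1 d1 z2 where z: "z1 < d1" "d1 < z2" "z2 < length w" "w ! z1 = z" "w ! d1 = d" "w ! z2 = z"
    using inside(3) unfolding subseq3_nth by blast
  show ?thesis
  proof
    assume "subseq [x, e, y] w"
    then obtain a b c where abc: "a < b" "b < c" "c < length w" "w ! a = x" "w ! b = e" "w ! c = y"
      unfolding subseq3_nth by blast
    \<comment> \<open>Otherwise \<open>e\<close> would lie between \<open>z\<close> and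
      \<open>y\<close>. Next, \<open>y2\<close> beyond \<open>d1\<close> would put \<open>d\<close>
      between \<open>x\<close> and \<open>y\<close>.\<close>
    have "b \<le> z1"
      using E[of z1 b c] abc z by force
    then have "y2 \<le> d1"
      using D[of a d1 y2] abc y z by force
    with y z show "subseq [y, f, z] w"
      unfolding subseq3_nth by (intro exI[of _ y1] exI[of _ f1] exI[of _ z2]) simp
  next
    assume "subseq [y, f, z] w"
    then obtain a b c where abc: "a < b" "b < c" "c < length w" "w ! a = y" "w ! b = f" "w ! c = z"
      unfolding subseq3_nth by blast
    \<comment> \<open>Otherwise \<open>f\<close> would lie between two \<open>z\<close>. Then
      \<open>x2\<close> beyond \<open>d1\<close> would put \<open>d\<close> between \<open>y\<close>
      and \<open>x\<close>, and finally \<open>y1\<close> before \<open>e1\<close> would put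
      \<open>e\<close> between \<open>y\<close> and \<open>z\<close>.\<close>
    have "b \<le> z1"
      using F[of z1 b c] abc z by force
    then have "x2 \<le> d1"
      using D[of a d1 x2] abc x z by force
    then have "e1 \<le> y1"
      using E[of y1 e1 z2] x y z by force
    with x y show "subseq [x, e, y] w"
      unfolding subseq3_nth by (intro exI[of _ x1] exI[of _ e1] exI[of _ y2]) simp
  qed
qed

lemma rising_Suc:
  assumes w: "(zig l N, w) \<in> identities_of (lee_monoid l)" and l: "l \<ge> 3" and j: "j + 3 \<le> N"
  shows "rising j w \<longleftrightarrow> rising (Suc j) w"
proof -
  note adj = zig_class_adjacent[OF w l] and nonadj = zig_class_nonadjacent[OF w l]
  have "subseq [2 * j + 1, 2 * j + 4, 2 * j + 3] w \<longleftrightarrow> subseq [2 * j + 3, 2 * j + 6, 2 * j + 5] w"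
  proof (rule subseq3_orientation[where d = "2 * j + 2"])
    show "\<not> subseq [p, 2 * j + 2, q] w" if "p \<in> {2 * j + 1, 2 * j + 3}" "q \<in> {2 * j + 1, 2 * j + 3}" for p q
      by (rule adj) (use that j in auto)
    show "\<not> subseq [p, 2 * j + 4, q] w" if "p \<in> {2 * j + 3, 2 * j + 5}" "q \<in> {2 * j + 3, 2 * j + 5}" for p q
      by (rule adj) (use that j in auto)
    show "\<not> subseq [2 * j + 5, 2 * j + 6, 2 * j + 5] w"
      by (rule adj) (use j in auto)
    show "subseq [2 * j + 1, 2 * j + 4, 2 * j + 1] w"
      by (rule nonadj) (use j in auto)
    show "subseq [2 * j + 3, 2 * j + 6, 2 * j + 3] w"
      by (rule nonadj) (use j in auto)
    show "subseq [2 * j + 5, 2 * j + 2, 2 * j + 5] w"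
      by (rule nonadj) (use j in auto)
  qed
  moreover have "2 * Suc j + 1 = 2 * j + 3" "2 * Suc j + 4 = 2 * j + 6" "2 * Suc j + 3 = 2 * j + 5"
    by simp_all
  ultimately show ?thesis by (simp only: rising_def)
qed

text \<open>The direction propagates along the path, so one pair of consecutive odd letters decides
  it for all pairs in range.\<close>

lemma rising_iff_0:
  assumes "(zig l N, w) \<in> identities_of (lee_monoid l)" "l \<ge> 3" "j + 2 \<le> N"
  shows "rising j w \<longleftrightarrow> rising 0 w"
  using assms(3)
proof (induction j)
  case (Suc j)
  then show ?case using rising_Suc[OF assms(1,2), of j] by simp
qed simp

text \<open>Pigeonhole: if no block contains the pattern, then \<open>2 * j + 1\<close> cannot occur in the first \<open>j\<close>
  blocks.\<close>

lemma rising_in_block: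
  assumes w: "(zig l N, concat bs) \<in> identities_of (lee_monoid l)" and l: "l \<ge> 3"
    and N: "length bs + 2 \<le> N" and rising: "rising 0 (concat bs)"
  shows "\<exists>b\<in>set bs. \<exists>j. j + 2 \<le> N \<and> rising j b"
proof (rule ccontr)
  assume contra: "\<not> ?thesis"
  have "2 * j + 1 \<notin> set (concat (take j bs))" if "j \<le> length bs" for j
    using that
  proof (induction j)
    case (Suc j)
    let ?L = "concat (take j bs)" and ?b = "bs ! j"
    have L: "concat (take (Suc j) bs) = ?L @ ?b"
      using Suc.prems by (simp add: take_Suc_conv_app_nth)
    have w_eq: "concat bs = (?L @ ?b) @ concat (drop (Suc j) bs)"
      unfolding L[symmetric] by (simp flip: concat_append)
    show ?case
    proof
      assume "2 * Suc j + 1 \<in> set (concat (take (Suc j) bs))"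
      moreover have "2 * Suc j + 1 = 2 * j + 3" by simp
      ultimately have "2 * j + 3 \<in> set (?L @ ?b)" by (simp only: L)
      then obtain k where k: "k < length (?L @ ?b)" "(?L @ ?b) ! k = 2 * j + 3"
        unfolding in_set_conv_nth by blast
      have "rising j (concat bs)"
        using rising_iff_0[OF w l] rising N Suc.prems by simp
      then obtain a b c where abc: "a < b" "b < c" "c < length (concat bs)"
        "concat bs ! a = 2 * j + 1" "concat bs ! b = 2 * j + 4" "concat bs ! c = 2 * j + 3"
        unfolding rising_def subseq3_nth by blast
      have nth: "concat bs ! m = (?L @ ?b) ! m" if "m < length (?L @ ?b)" for m
        unfolding w_eq nth_append[of "?L @ ?b"] by (simp only: that if_True)
      have k': "concat bs ! k = 2 * j + 3"
        using nth[OF k(1)] k(2) by (simp only:)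
      \<comment> \<open>This places the position \<open>k\<close> after \<open>b\<close>, so
        \<open>a\<close>, \<open>b\<close>, \<open>k\<close> form the pattern within the first
        \<open>j + 1\<close> blocks.\<close>
      have "\<not> subseq [2 * j + 3, 2 * j + 4, 2 * j + 3] (concat bs)"
        by (rule zig_class_adjacent[OF w l]) (use N Suc.prems in auto)
      then have "\<not> k < b"
        using abc k' unfolding subseq3_nth by blast
      moreover have "k \<noteq> b" using k' abc by auto
      ultimately have "b < k" by simp
      then have "(?L @ ?b) ! a = 2 * j + 1" "(?L @ ?b) ! b = 2 * j + 4"
        using nth[of a] nth[of b] abc k(1) by linarith+
      with \<open>b < k\<close> abc(1) k have "subseq [2 * j + 1, 2 * j + 4, 2 * j + 3] (?L @ ?b)"
        unfolding subseq3_nth by blast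
      \<comment> \<open>The first letter of the pattern is missing from the earlier blocks, so the
        whole pattern lies in block \<open>j\<close>.\<close>
      moreover have "2 * j + 1 \<notin> set ?L" using Suc by simp
      ultimately have "subseq [2 * j + 1, 2 * j + 4, 2 * j + 3] ?b"
        unfolding subseq3_append
        using subseq3_subset[of "2 * j + 1" "2 * j + 4" "2 * j + 3" ?L]
          subseq2_subset[of "2 * j + 1" "2 * j + 4" ?L] by blast
      then have "rising j ?b" by (simp add: rising_def)
      moreover have "?b \<in> set bs" "j + 2 \<le> N" using N Suc.prems by simp_all
      ultimately show False using contra by blast
    qed
  qed simp
  from this[of "length bs"] have "2 * length bs + 1 \<notin> set (concat bs)" by simp
  moreover have "rising (length bs) (concat bs)"
    using rising_iff_0[OF w l N] rising by simp
  ultimately show False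
    using subseq3_subset[of "2 * length bs + 1" "2 * length bs + 4" "2 * length bs + 3" "concat bs"]
    unfolding rising_def by blast
qed

section \<open>Deductions from short identities\<close>

lemma rising_mono: "rising j b \<Longrightarrow> rising j (p @ b @ q)"
  by (auto simp: rising_def intro: subseq_drop_many subseq_rev_drop_many)

text \<open>The word is cut into \<open>length s + 2\<close> blocks: \<open>p\<close>, the values of
  the letters of \<open>s\<close>, and \<open>q\<close>. A block carrying the pattern reappears
  after the step because \<open>s\<close> and \<open>t\<close> have the same letters, and
  \<open>rising_iff_0\<close> returns from its index \<open>j\<close> to 0.\<close>

lemma rising_step:
  assumes st: "(s, t) \<in> identities_of (lee_monoid l)" and l: "l \<ge> 3" and N: "length s + 4 \<le> N"
    and w: "(zig l N, p @ subst_word \<sigma> s @ q) \<in> identities_of (lee_monoid l)"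
    and rising: "rising 0 (p @ subst_word \<sigma> s @ q)"
  shows "(zig l N, p @ subst_word \<sigma> t @ q) \<in> identities_of (lee_monoid l) \<and>
    rising 0 (p @ subst_word \<sigma> t @ q)"
proof -
  have "deducible {(s, t)} (p @ subst_word \<sigma> s @ q) (p @ subst_word \<sigma> t @ q)"
    by (intro deducible_context deducible.subst deducible.ax) simp
  from deducible_sound[OF this] st l
  have "(p @ subst_word \<sigma> s @ q, p @ subst_word \<sigma> t @ q) \<in> identities_of (lee_monoid l)"
    by simp
  with w have w': "(zig l N, p @ subst_word \<sigma> t @ q) \<in> identities_of (lee_monoid l)"
    by (rule identities_of_trans)
  let ?bs = "p # map \<sigma> s @ [q]"
  have eq: "concat ?bs = p @ subst_word \<sigma> s @ q" by (simp add: subst_word_def)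
  obtain b j where b: "b \<in> set ?bs" "j + 2 \<le> N" "rising j b"
    using rising_in_block[of l N ?bs] w l N rising unfolding eq by auto
  have "set t = set s"
    using identity_set_eq[OF st] l by simp
  have "\<exists>p' q'. p @ subst_word \<sigma> t @ q = p' @ b @ q'"
  proof (cases "b = p \<or> b = q")
    case True
    then show ?thesis
    proof
      assume "b = p"
      then show ?thesis by (intro exI[of _ "[]"] exI[of _ "subst_word \<sigma> t @ q"]) simp
    next
      assume "b = q"
      then show ?thesis by (intro exI[of _ "p @ subst_word \<sigma> t"] exI[of _ "[]"]) simp
    qed
  next
    case False
    with b(1) obtain x where x: "x \<in> set s" "b = \<sigma> x" by auto
    with \<open>set t = set s\<close> obtain t1 t2 where "t = t1 @ x # t2" using split_list[of x t] by blast
    then show ?thesis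
      using x(2) by (intro exI[of _ "p @ concat (map \<sigma> t1)"] exI[of _ "concat (map \<sigma> t2) @ q"])
        (simp add: subst_word_def)
  qed
  then have "rising j (p @ subst_word \<sigma> t @ q)"
    using rising_mono[OF b(3)] by (elim exE) (simp only:)
  with rising_iff_0[OF w' l b(2)] w' show ?thesis by blast
qed

text \<open>Quantifying over contexts and substitutions lets the induction absorb the rules
  \<open>mult\<close> and \<open>subst\<close>: the former enlarges the context, the latter composes
  substitutions.\<close>

lemma rising_deducible:
  assumes "deducible \<Sigma> u v" "\<Sigma> \<subseteq> identities_of (lee_monoid l)" "l \<ge> 3"
    and N: "\<And>s t. (s, t) \<in> \<Sigma> \<Longrightarrow> length s + 4 \<le> N \<and> length t + 4 \<le> N"
  shows "(zig l N, p @ subst_word \<sigma> u @ q) \<in> identities_of (lee_monoid l) \<and>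
      rising 0 (p @ subst_word \<sigma> u @ q) \<longleftrightarrow>
    (zig l N, p @ subst_word \<sigma> v @ q) \<in> identities_of (lee_monoid l) \<and>
      rising 0 (p @ subst_word \<sigma> v @ q)"
  using assms(1)
proof (induction arbitrary: p q \<sigma>)
  case (ax s t)
  then have st: "(s, t) \<in> identities_of (lee_monoid l)" using assms(2) by blast
  show ?case
    using rising_step[OF st assms(3)] rising_step[OF identities_of_sym[OF st] assms(3)] N[OF ax]
    by blast
next
  case (mult u v u' v')
  show ?case
    using mult.IH(1)[of p \<sigma> "subst_word \<sigma> u' @ q"] mult.IH(2)[of "p @ subst_word \<sigma> v" \<sigma> q]
    by (simp add: subst_word_def)
next
  case (subst u v \<tau>)
  have "subst_word \<sigma> (subst_word \<tau> w) = subst_word (\<lambda>x. subst_word \<sigma> (\<tau> x)) w" for w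
    using replace_subst_word by (simp add: subst_word_def)
  then show ?case using subst.IH by simp
qed blast+

section \<open>Separating \<open>zig\<close> from \<open>zag\<close>\<close>

text \<open>Stage 2 contains 1 and 4, and 3 enters in stage 3. Two copies of stage 2 yield 1 before
  4 whatever the order inside a stage.\<close>

lemma rising_zig:
  assumes "N \<ge> 2" "l \<ge> 2"
  shows "rising 0 (zig l N)"
proof -
  obtain m where l: "l = Suc (Suc m)" using assms(2) by (metis add_2_eq_Suc le_Suc_ex)
  have "[0..<Suc (N + 1)] = [0..<2] @ [2, 3] @ [4..<Suc (N + 1)]"
    using assms(1) upt_add_eq_append[of 0 2 "N"] by (simp add: upt_conv_Cons)
  then obtain p q where "zig l N = p @ (repeat l (odd_rise N 2) @ repeat l (odd_rise N 3)) @ q"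
    unfolding zig_def stages_def by (simp del: upt_Suc)
  moreover have "1 \<in> set (odd_rise N 2)" "4 \<in> set (odd_rise N 2)" "3 \<in> set (odd_rise N 3)"
    using assms(1) by (auto simp: set_odd_rise)
  then have "rising 0 (repeat l (odd_rise N 2) @ repeat l (odd_rise N 3))"
    by (auto simp: l rising_def subseq2_append subseq3_append)
  ultimately show ?thesis
    using rising_mono[of 0 "repeat l (odd_rise N 2) @ repeat l (odd_rise N 3)" p q] by (simp only:)
qed

text \<open>Cut \<open>zag\<close> into \<open>u\<close>, \<open>v\<close>, \<open>w\<close> lacking
  1, 4 and 3, respectively. In a subsequence 1, 4, 3 the 1 would lie after \<open>u\<close>, hence
  the 4 in \<open>w\<close>, where no 3 can follow.\<close>

lemma not_rising_zag:
  assumes "N \<ge> 2"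
  shows "\<not> rising 0 (zag l N)"
proof -
  define u where "u = concat (map (repeat l) (map (even_rise N) (rev [1..<Suc (N + 1)])))"
  define v where "v = concat (map (repeat l) (even_rise N 0 # map (odd_rise N) (rev [3..<Suc (N + 1)])))"
  define w where "w = concat (map (repeat l) (map (odd_rise N) (rev [0..<3])))"
  have upt: "[0..<Suc (N + 1)] = 0 # [1..<Suc (N + 1)]" "[0..<Suc (N + 1)] = [0..<3] @ [3..<Suc (N + 1)]"
    using assms upt_add_eq_append[of 0 3 "N - 1"] by (simp_all add: upt_conv_Cons)
  have r1: "rev [0..<Suc (N + 1)] = rev [1..<Suc (N + 1)] @ [0]"
    unfolding upt(1) by (simp only: rev.simps)
  have r2: "rev [0..<Suc (N + 1)] = rev [3..<Suc (N + 1)] @ rev [0..<3]"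
    unfolding upt(2) by (simp only: rev_append)
  have "rev (stages N) = map (even_rise N) es @ map (odd_rise N) os"
    if "rev [0..<Suc (N + 1)] = es" "rev [0..<Suc (N + 1)] = os" for es os
    unfolding that[symmetric] stages_def by (simp only: rev_append rev_map)
  from this[OF r1 r2] have "zag l N = u @ v @ w"
    unfolding zag_def u_def v_def w_def
    by (simp only: map_append concat_append append.assoc list.map concat.simps append_Nil append_Nil2 append_Cons)
  moreover have "1 \<notin> set u" "4 \<notin> set v" "3 \<notin> set w"
    by (auto simp: u_def v_def w_def set_odd_rise set_even_rise)
  moreover have "rising 0 (zag l N) \<longleftrightarrow> subseq [1, 4, 3] (zag l N)"
    by (simp add: rising_def)
  ultimately show ?thesis
    using subseq3_subset[of 1 4 3 u] subseq3_subset[of 1 4 3 v] subseq3_subset[of 1 4 3 w]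
      subseq2_subset[of 1 4 u] subseq2_subset[of 1 4 v] subseq2_subset[of 4 3 v] subseq2_subset[of 4 3 w]
    by (simp only: subseq3_append subseq2_append) (simp only: set_append, blast)
qed

theorem not_finitely_based_lee_monoid:
  assumes l: "l \<ge> 3"
  shows "\<not> finitely_based (lee_monoid l)"
proof
  assume "finitely_based (lee_monoid l)"
  then obtain \<Sigma> where \<Sigma>: "\<Sigma> \<subseteq> identities_of (lee_monoid l)" "finite \<Sigma>"
    and complete: "\<And>u v. (u, v) \<in> identities_of (lee_monoid l) \<Longrightarrow> deducible \<Sigma> u v"
    unfolding finitely_based_def by blast
  let ?len = "\<lambda>(s, t). length s + length t"
  \<comment> \<open>The inserted 0 covers an empty basis; the summand 4 is the slack demanded by
    \<open>rising_deducible\<close>.\<close>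
  define N where "N = Max (insert 0 (?len ` \<Sigma>)) + 4"
  have N: "length s + 4 \<le> N \<and> length t + 4 \<le> N" if "(s, t) \<in> \<Sigma>" for s t
  proof -
    have "?len (s, t) \<le> Max (insert 0 (?len ` \<Sigma>))"
      using \<Sigma>(2) that by (intro Max_ge) auto
    then show ?thesis by (simp add: N_def)
  qed
  have "N \<ge> 4" by (simp add: N_def)
  have id: "subst_word (\<lambda>x. [x]) w = w" for w
    by (induction w) (simp_all add: subst_word_def)
  have "deducible \<Sigma> (zig l N) (zag l N)"
    using zig_zag_identity l by (intro complete) simp
  from rising_deducible[OF this \<Sigma>(1) l N, of "[]" "\<lambda>x. [x]" "[]"]
  have "rising 0 (zig l N) \<longrightarrow> rising 0 (zag l N)"
    by (simp add: id identities_of_def)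
  then show False
    using rising_zig[of N l] not_rising_zag[of N l] \<open>N \<ge> 4\<close> l by simp
qed

theorem theorem2p2:
  fixes l :: nat
  assumes "l \<ge> 2"
  shows "finitely_based (lee_monoid l) \<longleftrightarrow> l = 2"
  using assms finitely_based_lee_monoid_2 not_finitely_based_lee_monoid[of l]
  by (cases "l = 2") auto

end
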